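(* Let $X$ be a nontrivial complex Banach space with the Radon-Nikodým property. The following are equivalent: (1) $n_u(X)=1$. (2) For each $x\in \rho A_u(B_X)$ and each $x^*\in \mathrm{ext}(B_{X^*})$, we have $|x^*(x)|=1$. In addition, when $X$ is separable, $n_u(X)=1$ if and only if $|x^*(x)|=1$ for each $x\in \rho A_u(B_X)$ and each $x^*\in w^*\mathrm{exp}(B_{X^*})$.
   Context: $X^*$ is the dual of $X$, and $B_X$, $B_{X^*}$ are the closed unit balls. For complex Banach spaces $X,Y$, $C_b(B_X:Y)$ is the Banach space of bounded continuous functions $f:B_X\to Y$ with $\|f\|=\sup_{x\in B_X}\|f(x)\|$; $A_u(B_X:Y)$ is the subspace of those $f$ that are holomorphic on the open unit ball $B_X^\circ$ and uniformly continuous on $B_X$; $A_u(B_X)=A_u(B_X:\mathbb{C})$. Let $\Pi(X)=\{(x,x^* )\in B_X\times B_{X^*}: x^*(x)=1=\|x\|=\|x^*\|\}$. The numerical radius of $f\in C_b(B_X:X)$ is $v(f)=\sup\{|x^*f(x)|:(x,x^* )\in\Pi(X)\}$, and the holomorphic numerical index is $n_u(X)=\inf\{v(f):f\in A_u(B_X:X),\ \|f\|=1\}$. A nonzero $f\in C_b(B_X:Y)$ is a strong peak function at $x_0\in B_X$ if whenever $(x_n)$ is a sequence in $B_X$ with $\lim_n\|f(x_n)\|=\|f\|$, the sequence $(x_n)$ converges in norm to $x_0$. For a subspace $H$ of $C_b(B_X:Y)$, $\rho H$ is the set of all $x_0$ such that some $f\in H$ is a strong peak function at $x_0$. $\mathrm{ext}(K)$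 is the set of extreme points of a convex set $K$. A point $x^*\in B_{X^*}$ is a weak-$*$ exposed point of $B_{X^*}$ if there is $x\in B_X$ such that $x^*(x)=1$ and such that $y^*(x)=1$ with $y^*\in B_{X^*}$ implies $y^*=x^*$; $w^*\mathrm{exp}(B_{X^*})$ is the set of all such points. A point $x$ of a nonempty convex set $K\subset X$ is strongly exposed if there is a nonzero $x^*\in B_{X^*}$ with $\mathrm{Re}\,x^*(x)=\sup_{y\in K}\mathrm{Re}\,x^*(y)$ such that whenever $(x_n)\subset K$ and $\mathrm{Re}\,x^*(x_n)\to\mathrm{Re}\,x^*(x)$, one has $\|x_n-x\|\to0$. $X$ has the Radon-Nikodým property if every nonempty bounded closed convex subset of $X$ is the closed convex hull of its strongly exposed points. *)

theory Defs
  imports "HOL-Analysis.Analysis"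
begin

class scaleC =
  fixes scaleC :: "complex \<Rightarrow> 'a \<Rightarrow> 'a"  (infixr \<open>*\<^sub>C\<close> 75)

class complex_normed_vector = real_normed_vector + scaleC +
  assumes scaleR_scaleC: "r *\<^sub>R x = complex_of_real r *\<^sub>C x"
    and scaleC_add_right: "a *\<^sub>C (x + y) = a *\<^sub>C x + a *\<^sub>C y"
    and scaleC_add_left: "(a + b) *\<^sub>C x = a *\<^sub>C x + b *\<^sub>C x"
    and scaleC_scaleC: "a *\<^sub>C b *\<^sub>C x = (a * b) *\<^sub>C x"
    and scaleC_one: "1 *\<^sub>C x = x"
    and norm_scaleC: "norm (a *\<^sub>C x) = cmod a * norm x"

class complex_banach = complex_normed_vector + banach

instantiation complex :: complex_banach
begin

definition scaleC_complex :: "complex \<Rightarrow> complex \<Rightarrow> complex"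
  where "scaleC_complex a x = a * x"

instance
  by standard (simp_all add: scaleC_complex_def scaleR_conv_of_real algebra_simps norm_mult)

end

text \<open>
  The type \<open>'a \<Rightarrow>\<^sub>L complex\<close> consists of the bounded \<^emph>\<open>real\<close>-linear maps with the operator
  norm; the dual of the complex space is its subspace of complex-linear maps.
\<close>

definition complex_dual :: "('a::complex_normed_vector \<Rightarrow>\<^sub>L complex) set"
  where "complex_dual =
    {xs. \<forall>c x. blinfun_apply xs (c *\<^sub>C x) = c * blinfun_apply xs x}"

definition dual_ball :: "('a::complex_normed_vector \<Rightarrow>\<^sub>L complex) set"
  where "dual_ball = {xs \<in> complex_dual. norm xs \<le> 1}"

text \<open>
  A function on \<open>B\<^sub>X\<close> is represented by a total function of which only the values on
  \<open>cball 0 1\<close> matter: everything below is insensitive to the values elsewhere.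
\<close>

definition C_b :: "('a::complex_banach \<Rightarrow> 'b::complex_banach) set"
  where "C_b = {f. continuous_on (cball 0 1) f \<and> bounded (f ` cball 0 1)}"

definition ball_norm :: "('a::complex_banach \<Rightarrow> 'b::complex_banach) \<Rightarrow> real"
  where "ball_norm f = (SUP x\<in>cball 0 1. norm (f x))"

definition frechet_holomorphic_on ::
    "('a::complex_banach \<Rightarrow> 'b::complex_banach) \<Rightarrow> 'a set \<Rightarrow> bool"
  where "frechet_holomorphic_on f U \<longleftrightarrow>
    (\<forall>x\<in>U. \<exists>D. (f has_derivative D) (at x) \<and> (\<forall>c v. D (c *\<^sub>C v) = c *\<^sub>C D v))"

definition A_u :: "('a::complex_banach \<Rightarrow> 'b::complex_banach) set"
  where "A_u = {f \<in> C_b. frechet_holomorphic_on f (ball 0 1) \<and>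
                          uniformly_continuous_on (cball 0 1) f}"

definition Pi_states :: "('a::complex_banach \<times> ('a \<Rightarrow>\<^sub>L complex)) set"
  where "Pi_states = {(x, xs). x \<in> cball 0 1 \<and> xs \<in> dual_ball \<and>
                        blinfun_apply xs x = 1 \<and> norm x = 1 \<and> norm xs = 1}"

definition numerical_radius :: "('a::complex_banach \<Rightarrow> 'a) \<Rightarrow> real"
  where "numerical_radius f = (SUP (x, xs)\<in>Pi_states. cmod (blinfun_apply xs (f x)))"

definition n_u :: "'a::complex_banach itself \<Rightarrow> real"
  where "n_u _ = (INF f\<in>{f :: 'a \<Rightarrow> 'a. f \<in> A_u \<and> ball_norm f = 1}. numerical_radius f)"

definition strong_peak_at :: "('a::complex_banach \<Rightarrow> 'b::complex_banach) \<Rightarrow> 'a \<Rightarrow> bool"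
  where "strong_peak_at f x0 \<longleftrightarrow>
    f \<in> C_b \<and> (\<exists>x\<in>cball 0 1. f x \<noteq> 0) \<and> x0 \<in> cball 0 1 \<and>
    (\<forall>X. (\<forall>n. X n \<in> cball 0 1) \<longrightarrow> (\<lambda>n. norm (f (X n))) \<longlonglongrightarrow> ball_norm f \<longrightarrow>
         X \<longlonglongrightarrow> x0)"

definition strong_peak_points :: "('a::complex_banach \<Rightarrow> 'b::complex_banach) set \<Rightarrow> 'a set"
  where "strong_peak_points H = {x0. \<exists>f\<in>H. strong_peak_at f x0}"

definition weak_star_exposed :: "('a::complex_banach \<Rightarrow>\<^sub>L complex) set"
  where "weak_star_exposed = {xs \<in> dual_ball. \<exists>x\<in>cball 0 1.
    blinfun_apply xs x = 1 \<and> (\<forall>ys\<in>dual_ball. blinfun_apply ys x = 1 \<longrightarrow> ys = xs)}"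

text \<open>The condition \<open>bdd_above\<close> makes the real supremum meaningful when \<open>K\<close> is unbounded.\<close>

definition strongly_exposed_point :: "'a::complex_banach \<Rightarrow> 'a set \<Rightarrow> bool"
  where "strongly_exposed_point x K \<longleftrightarrow> x \<in> K \<and>
    (\<exists>xs\<in>dual_ball. xs \<noteq> 0 \<and>
       bdd_above ((\<lambda>y. Re (blinfun_apply xs y)) ` K) \<and>
       Re (blinfun_apply xs x) = (SUP y\<in>K. Re (blinfun_apply xs y)) \<and>
       (\<forall>X. (\<forall>n. X n \<in> K) \<longrightarrow>
            (\<lambda>n. Re (blinfun_apply xs (X n))) \<longlonglongrightarrow> Re (blinfun_apply xs x) \<longrightarrow>
            (\<lambda>n. norm (X n - x)) \<longlonglongrightarrow> 0))"

definition radon_nikodym_property :: "'a::complex_banach itself \<Rightarrow> bool"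
  where "radon_nikodym_property _ \<longleftrightarrow>
    (\<forall>K :: 'a set. K \<noteq> {} \<and> bounded K \<and> closed K \<and> convex K \<longrightarrow>
       K = closure (convex hull {x. strongly_exposed_point x K}))"

end

theory Submission
  imports Defs
begin

text \<open>
  A strong peak point \<open>x0\<close> of a function \<open>f\<close> is tested against the maps
  \<open>x \<mapsto> (f x / ball_norm f) *\<^sub>C y\<close>: if the numerical index is 1, these have numerical radius 1,
  which forces functionals that are almost unimodular at \<open>x0\<close> and at \<open>y\<close> simultaneously. Those
  are norming, so by a Milman type argument the extreme functionals are unimodular at \<open>x0\<close>.

  Conversely, by the Radon--Nikodym property and Stegall's principle, \<open>Re F\<close> has small linear
  perturbations with a strong maximum on the ball for every scalar \<open>F\<close> in \<open>A_u\<close>. Exponentiating,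
  strong peak points come close to the norm of every map \<open>f\<close> in \<open>A_u\<close>; at such a point \<open>x\<close>, an
  extreme (or, by Mazur's theorem in the separable case, weak-* exposed) functional that almost
  norms \<open>f x\<close> is unimodular at \<open>x\<close>, hence yields a state.
\<close>

subsection \<open>Sublinear functionals and extreme points\<close>

text \<open>The extreme points needed live in the dual ball, which is compact only in the weak-*
  topology. That topology never appears: a weak-* compact convex set of functionals is represented
  by its support functional, which is sublinear on the space itself. Passing to a face, intersecting
  a chain and taking the hull of a finite union become a directional derivative, an infimum and a
  maximum. The Radon-Nikodym property concerns slices by linear functionals, while the functions to
  be maximized are not linear. The link is that every bounded set has small slices, which is applied
  to the set of all minimizers of perturbations of one convex function. The perturbation obtained is
  only real-linear, but it is the real part of a complex functional, and adding the latter does not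
  leave \<open>A_u\<close>.\<close>

definition sublinear :: "('v::real_vector \<Rightarrow> real) \<Rightarrow> bool"
  where "sublinear p \<longleftrightarrow>
    (\<forall>x y. p (x + y) \<le> p x + p y) \<and> (\<forall>c x. 0 \<le> c \<longrightarrow> p (c *\<^sub>R x) = c * p x)"

text \<open>For functionals defined as infima or suprema only one inequality of homogeneity is
  immediate; the other one is the same inequality for \<open>inverse c\<close>.\<close>

lemma sublinearI:
  assumes "\<And>x y. p (x + y) \<le> p x + p y"
    and "\<And>c x. 0 < c \<Longrightarrow> p (c *\<^sub>R x) \<le> c * p x"
    and "p 0 = 0"
  shows "sublinear p"
proof -
  have "p (c *\<^sub>R x) = c * p x" if "0 < c" for c x
  proof -
    have "p x \<le> inverse c * p (c *\<^sub>R x)"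
      using assms(2)[of "inverse c" "c *\<^sub>R x"] that by simp
    then have "c * p x \<le> p (c *\<^sub>R x)"
      using that by (simp add: field_simps)
    then show ?thesis using assms(2)[OF that, of x] by simp
  qed
  then show ?thesis
    unfolding sublinear_def using assms(1,3) by (metis less_eq_real_def mult_zero_left scaleR_zero_left)
qed

lemma sublinear_add: "sublinear p \<Longrightarrow> p (x + y) \<le> p x + p y"
  and sublinear_scale: "sublinear p \<Longrightarrow> 0 \<le> c \<Longrightarrow> p (c *\<^sub>R x) = c * p x"
  by (auto simp: sublinear_def)

lemma sublinear_zero: "sublinear p \<Longrightarrow> p 0 = 0"
  using sublinear_scale[of p 0 0] by simp

lemma sublinear_minus: "sublinear p \<Longrightarrow> - p (- x) \<le> p x"
  using sublinear_add[of p x "- x"] sublinear_zero[of p] by simp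

lemma sublinear_norm: "sublinear norm"
  by (auto simp: sublinear_def norm_triangle_ineq)

lemma sublinear_max:
  assumes "sublinear p" "sublinear q"
  shows "sublinear (\<lambda>x. max (p x) (q x))"
proof (rule sublinearI)
  show "max (p (x + y)) (q (x + y)) \<le> max (p x) (q x) + max (p y) (q y)" for x y
    using sublinear_add[OF assms(1), of x y] sublinear_add[OF assms(2), of x y] by linarith
  show "max (p (c *\<^sub>R x)) (q (c *\<^sub>R x)) \<le> c * max (p x) (q x)" if "0 < c" for c x
    using that assms by (auto simp: sublinear_scale max_def)
qed (use assms in \<open>simp add: sublinear_zero\<close>)

text \<open>
  If \<open>q\<close> is the support functional of a set of linear functionals, the following is that of its
  face on which evaluation at \<open>y\<close> is maximal.
\<close>
definition face_functional :: "('v::real_vector \<Rightarrow> real) \<Rightarrow> 'v \<Rightarrow> 'v \<Rightarrow> real"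
  where "face_functional q y x = (INF t\<in>{0..}. q (x + t *\<^sub>R y) - t * q y)"

text \<open>For t > 0 the term in the infimum is t (q (y + x / t) - q y), which decreases in t by
  subadditivity; so the infimum is the directional derivative of q at y along x. A linear f below q
  with f y = q y satisfies f x = f (x + t y) - t q y, hence lies below every term.\<close>

lemma
  assumes q: "sublinear q"
  shows face_functional_le: "0 \<le> t \<Longrightarrow> face_functional q y x \<le> q (x + t *\<^sub>R y) - t * q y"
    and sublinear_face_functional: "sublinear (face_functional q y)"
    and face_functional_uminus: "face_functional q y (- y) \<le> - q y"
    and face_functional_greatest:
      "linear f \<Longrightarrow> (\<And>x. f x \<le> q x) \<Longrightarrow> f y = q y \<Longrightarrow> f x \<le> face_functional q y x"
proof -
  have lb: "- q (- x) \<le> q (x + t *\<^sub>R y) - t * q y" if "0 \<le> t" for t x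
    using sublinear_add[OF q, of "x + t *\<^sub>R y" "- x"] sublinear_scale[OF q that, of y] by simp
  have bdd: "bdd_below ((\<lambda>t. q (x + t *\<^sub>R y) - t * q y) ` {0..})" for x
    by (rule bdd_belowI[of _ "- q (- x)"]) (use lb in auto)
  show le: "face_functional q y x \<le> q (x + t *\<^sub>R y) - t * q y" if "0 \<le> t" for t x
    unfolding face_functional_def by (rule cINF_lower[OF bdd]) (use that in auto)
  have ge: "c \<le> face_functional q y x" if "\<And>t. 0 \<le> t \<Longrightarrow> c \<le> q (x + t *\<^sub>R y) - t * q y" for c x
    unfolding face_functional_def by (rule cINF_greatest) (use that in auto)
  show "face_functional q y (- y) \<le> - q y"
    using le[of 1 "- y"] sublinear_zero[OF q] by simp
  show "sublinear (face_functional q y)"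
  proof (rule sublinearI)
    fix u v
    \<comment> \<open>The two infima on the right have independent parameters s and t; the parameter
      s + t on the left serves both.\<close>
    have *: "face_functional q y (u + v) \<le> (q (u + s *\<^sub>R y) - s * q y) + (q (v + t *\<^sub>R y) - t * q y)"
      if "0 \<le> s" "0 \<le> t" for s t
      using le[of "s + t" "u + v"] that sublinear_add[OF q, of "u + s *\<^sub>R y" "v + t *\<^sub>R y"]
      by (simp add: algebra_simps)
    have "face_functional q y (u + v) - face_functional q y v \<le> q (u + s *\<^sub>R y) - s * q y"
      if "0 \<le> s" for s
    proof -
      have "face_functional q y (u + v) - (q (u + s *\<^sub>R y) - s * q y) \<le> face_functional q y v"
        by (rule ge) (use *[OF that] in \<open>auto simp: algebra_simps\<close>)
      then show ?thesis by simp
    qed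
    from ge[OF this] show "face_functional q y (u + v) \<le> face_functional q y u + face_functional q y v"
      by simp
  next
    fix c :: real and x assume c: "0 < c"
    have "inverse c * face_functional q y (c *\<^sub>R x) \<le> q (x + t *\<^sub>R y) - t * q y" if "0 \<le> t" for t
    proof -
      have "face_functional q y (c *\<^sub>R x) \<le> q (c *\<^sub>R (x + t *\<^sub>R y)) - c * t * q y"
        using le[of "c * t" "c *\<^sub>R x"] c that by (simp add: scaleR_add_right algebra_simps)
      then show ?thesis
        using c unfolding sublinear_scale[OF q less_imp_le[OF c]] by (simp add: field_simps)
    qed
    from ge[OF this] show "face_functional q y (c *\<^sub>R x) \<le> c * face_functional q y x"
      using c by (simp add: field_simps)
  next
    show "face_functional q y 0 = 0"
      using le[of 0 0] ge[of 0 0] sublinear_scale[OF q, of _ y] by (simp add: sublinear_zero[OF q])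
  qed
  show "f x \<le> face_functional q y x" if "linear f" "\<And>x. f x \<le> q x" "f y = q y"
  proof (rule ge)
    show "f x \<le> q (x + t *\<^sub>R y) - t * q y" for t
      using that(2)[of "x + t *\<^sub>R y"] that(3)
      by (simp add: linear_add[OF that(1)] linear_scale[OF that(1)])
  qed
qed

text \<open>In the subadditivity proof two members of \<open>C\<close> are chosen independently, and
  the chain condition supplies one below both. The common bound \<open>p\<close> keeps the infimum
  finite, since q x is at least - q (- x) and hence at least - p (- x).\<close>

lemma sublinear_INF_chain:
  assumes "C \<noteq> {}" and sub: "\<And>q. q \<in> C \<Longrightarrow> sublinear q"
    and chain: "\<And>q r. q \<in> C \<Longrightarrow> r \<in> C \<Longrightarrow> q \<le> r \<or> r \<le> q"
    and bound: "\<And>q x. q \<in> C \<Longrightarrow> q x \<le> p x"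
  shows "sublinear (\<lambda>x. INF q\<in>C. q x)" (is "sublinear ?u")
    and "q \<in> C \<Longrightarrow> (INF q\<in>C. q x) \<le> q x"
proof -
  have bdd: "bdd_below ((\<lambda>q. q x) ` C)" for x
    by (rule bdd_belowI[of _ "- p (- x)"])
      (use sublinear_minus sub bound in \<open>auto, smt (verit, ccfv_SIG)\<close>)
  show le: "?u x \<le> q x" if "q \<in> C" for q x
    by (rule cINF_lower[OF bdd that])
  have ge: "c \<le> ?u x" if "\<And>q. q \<in> C \<Longrightarrow> c \<le> q x" for c x
    by (rule cINF_greatest[OF \<open>C \<noteq> {}\<close> that])
  show "sublinear ?u"
  proof (rule sublinearI)
    fix x y
    have *: "?u (x + y) \<le> q x + r y" if qr: "q \<in> C" "r \<in> C" for q r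
    proof -
      obtain s where "s \<in> C" "s \<le> q" "s \<le> r" using chain[OF qr] qr by blast
      then have "?u (x + y) \<le> s x + s y" using le[of s "x + y"] sublinear_add[OF sub, of s x y] by simp
      also have "\<dots> \<le> q x + r y" using \<open>s \<le> q\<close> \<open>s \<le> r\<close> by (simp add: le_fun_def add_mono)
      finally show ?thesis .
    qed
    have "?u (x + y) - ?u y \<le> q x" if "q \<in> C" for q
    proof -
      have "?u (x + y) - q x \<le> ?u y" by (rule ge) (use *[OF that] in \<open>auto simp: algebra_simps\<close>)
      then show ?thesis by simp
    qed
    then have "?u (x + y) - ?u y \<le> ?u x" by (rule ge)
    then show "?u (x + y) \<le> ?u x + ?u y" by simp
  next
    fix c :: real and x assume c: "0 < c"
    have "inverse c * ?u (c *\<^sub>R x) \<le> q x" if "q \<in> C" for q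
      using le[OF that, of "c *\<^sub>R x"] sublinear_scale[OF sub[OF that], of c x] c
      by (simp add: field_simps)
    then have "inverse c * ?u (c *\<^sub>R x) \<le> ?u x" by (rule ge)
    then show "?u (c *\<^sub>R x) \<le> c * ?u x"
      using c by (simp add: field_simps)
  next
    show "?u 0 = 0" using \<open>C \<noteq> {}\<close> sub by (simp add: sublinear_zero)
  qed
qed

text \<open>
  Zorn's lemma is applied to the sublinear functionals below \<open>p\<close> that define an extremal subset of
  the functionals dominated by \<open>p\<close>. A minimal one coincides with its own face functionals and is
  therefore linear, which gives the Hahn--Banach and the Krein--Milman theorem in one stroke.
\<close>
theorem extreme_dominated_functional_exists:
  assumes p: "sublinear (p :: 'v::real_vector \<Rightarrow> real)"
  obtains f where "linear f" "\<And>x. f x \<le> p x"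
    "\<And>g h u. linear g \<Longrightarrow> linear h \<Longrightarrow> (\<And>x. g x \<le> p x) \<Longrightarrow> (\<And>x. h x \<le> p x) \<Longrightarrow>
       0 < u \<Longrightarrow> u < 1 \<Longrightarrow> (\<And>x. f x = (1 - u) * g x + u * h x) \<Longrightarrow> g = f \<and> h = f"
proof -
  \<comment> \<open>Extremality of the set of functionals below \<open>q\<close> inside the set of
    those below \<open>p\<close>: a proper convex combination lies below \<open>q\<close> only if
    both of its ends do.\<close>
  define ext where "ext q \<longleftrightarrow> (\<forall>g h u. linear g \<longrightarrow> linear h \<longrightarrow> (\<forall>x. g x \<le> p x) \<longrightarrow> (\<forall>x. h x \<le> p x) \<longrightarrow>
    0 < u \<longrightarrow> u < 1 \<longrightarrow> (\<forall>x. (1 - u) * g x + u * h x \<le> q x) \<longrightarrow> (\<forall>x. g x \<le> q x) \<and> (\<forall>x. h x \<le> q x))"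
    for q :: "'v \<Rightarrow> real" and u :: real
  define S where "S = {q. sublinear q \<and> q \<le> p \<and> ext q}"
  have po: "partial_order_on S (relation_of (\<lambda>a b. b \<le> a) S)"
    by (rule partial_order_on_relation_ofI) auto
  have "\<exists>m\<in>S. \<forall>a\<in>S. a \<le> m \<longrightarrow> a = m"
  proof (rule predicate_Zorn[OF po])
    fix C assume C: "C \<in> Chains (relation_of (\<lambda>a b. b \<le> a) S)"
    have CS: "C \<subseteq> S" and chain: "\<And>q r. q \<in> C \<Longrightarrow> r \<in> C \<Longrightarrow> q \<le> r \<or> r \<le> q"
      using C by (auto simp: Chains_def relation_of_def)
    show "\<exists>u\<in>S. \<forall>a\<in>C. u \<le> a"
    proof (cases "C = {}")
      case True
      have "p \<in> S" using p by (auto simp: S_def ext_def)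
      with True show ?thesis by auto
    next
      case False
      let ?u = "\<lambda>x. INF q\<in>C. q x"
      have sub: "\<And>q. q \<in> C \<Longrightarrow> sublinear q" and bound: "\<And>q x. q \<in> C \<Longrightarrow> q x \<le> p x"
        and e: "\<And>q. q \<in> C \<Longrightarrow> ext q"
        using CS by (auto simp: S_def le_fun_def)
      have u: "sublinear ?u" "\<And>q x. q \<in> C \<Longrightarrow> ?u x \<le> q x"
        using sublinear_INF_chain[where p=p and C=C] False sub chain bound by blast+
      have "?u \<le> p" unfolding le_fun_def using u(2) bound False by (meson ex_in_conv order_trans)
      moreover have "ext ?u"
        unfolding ext_def
      proof (intro allI impI)
        fix g h u
        assume gh: "linear g" "linear h" "\<forall>x. g x \<le> p x" "\<forall>x. h x \<le> p x" "0 < u" "u < 1"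
          "\<forall>x. (1 - u) * g x + u * h x \<le> ?u x"
        have "(\<forall>x. g x \<le> q x) \<and> (\<forall>x. h x \<le> q x)" if "q \<in> C" for q
        proof -
          have "\<forall>x. (1 - u) * g x + u * h x \<le> q x" using gh(7) u(2)[OF that] by (meson order_trans)
          then show ?thesis using e[OF that] gh unfolding ext_def by blast
        qed
        then show "(\<forall>x. g x \<le> ?u x) \<and> (\<forall>x. h x \<le> ?u x)"
          using False by (auto intro!: cINF_greatest)
      qed
      ultimately have "?u \<in> S" using u(1) by (auto simp: S_def)
      moreover have "\<forall>a\<in>C. ?u \<le> a" using u(2) by (auto simp: le_fun_def)
      ultimately show ?thesis by blast
    qed
  qed
  then obtain q where qS: "q \<in> S" and min: "\<And>a. a \<in> S \<Longrightarrow> a \<le> q \<Longrightarrow> a = q" by blast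
  have q: "sublinear q" and qp: "q \<le> p" and qe: "ext q" using qS by (auto simp: S_def)
  have neg: "q (- y) = - q y" for y
  proof -
    let ?r = "face_functional q y"
    have rq: "?r \<le> q" using face_functional_le[OF q, of 0 y] by (simp add: le_fun_def)
    have "ext ?r"
      unfolding ext_def
    proof (intro allI impI)
      fix g h u
      assume gh: "linear g" "linear h" "\<forall>x. g x \<le> p x" "\<forall>x. h x \<le> p x" "0 < u" "u < 1"
        "\<forall>x. (1 - u) * g x + u * h x \<le> ?r x"
      have "\<forall>x. (1 - u) * g x + u * h x \<le> q x" using gh(7) rq unfolding le_fun_def by (meson order_trans)
      then have le: "(\<forall>x. g x \<le> q x)" "(\<forall>x. h x \<le> q x)" using qe gh unfolding ext_def by blast+
      have "(1 - u) * g (- y) + u * h (- y) \<le> - q y"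
        using gh(7)[rule_format, of "- y"] face_functional_uminus[OF q, of y] by linarith
      \<comment> \<open>The combination attains the maximal value \<open>q y\<close> at y, and
        neither end exceeds it there, so both ends attain it and belong to the face.\<close>
      then have "(1 - u) * (q y - g y) + u * (q y - h y) \<le> 0"
        using gh(1,2) by (simp add: linear_neg algebra_simps)
      moreover have "0 \<le> (1 - u) * (q y - g y)" "0 \<le> u * (q y - h y)"
        using le gh(5,6) by (auto intro!: mult_nonneg_nonneg)
      ultimately have "(1 - u) * (q y - g y) = 0" "u * (q y - h y) = 0" by linarith+
      then have "g y = q y" "h y = q y" using gh(5,6) by auto
      then show "(\<forall>x. g x \<le> ?r x) \<and> (\<forall>x. h x \<le> ?r x)"
        using face_functional_greatest[OF q] gh(1,2) le by blast
    qed
    then have "?r \<in> S" using sublinear_face_functional[OF q] rq qp by (auto simp: S_def)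
    then have "?r = q" using min rq by blast
    then show ?thesis using face_functional_uminus[OF q, of y] sublinear_minus[OF q, of y] by simp
  qed
  have "linear q"
  proof (rule linearI)
    show "q (x + y) = q x + q y" for x y
      using sublinear_add[OF q, of x y] sublinear_add[OF q, of "- x" "- y"] neg[of x] neg[of y]
        neg[of "x + y"] by simp
    show "q (c *\<^sub>R x) = c *\<^sub>R q x" for c x
    proof (cases "0 \<le> c")
      case False
      then have "q (c *\<^sub>R x) = - q ((- c) *\<^sub>R x)" using neg[of "(- c) *\<^sub>R x"] by simp
      then show ?thesis using False sublinear_scale[OF q, of "- c" x] by simp
    qed (simp add: sublinear_scale[OF q])
  qed
  moreover have "g = q \<and> h = q"
    if gh: "linear g" "linear h" "\<And>x. g x \<le> p x" "\<And>x. h x \<le> p x" "0 < u" "u < 1"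
      "\<And>x. q x = (1 - u) * g x + u * h x" for g h u
  proof -
    have "(\<forall>x. (1 - u) * g x + u * h x \<le> q x)" using gh(7) by simp
    then have le: "(\<forall>x. g x \<le> q x) \<and> (\<forall>x. h x \<le> q x)" using qe gh(1-6) unfolding ext_def by blast
    have "g x = q x \<and> h x = q x" for x
      using le[THEN conjunct1, rule_format, of x] le[THEN conjunct1, rule_format, of "- x"]
        le[THEN conjunct2, rule_format, of x] le[THEN conjunct2, rule_format, of "- x"] gh(1,2) neg[of x]
      by (simp add: linear_neg)
    then show ?thesis by auto
  qed
  ultimately show thesis using that[of q] qp by (auto simp: le_fun_def)
qed

text \<open>The Hahn-Banach form in which separation is used below: an infimum is shown to be
  sublinear, and a linear functional under it has the desired bounds.\<close>

corollary dominated_functional_exists: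
  assumes "sublinear p"
  obtains f where "linear f" "\<And>x. f x \<le> p x"
  by (rule extreme_dominated_functional_exists[OF assms]) (rule that)

text \<open>
  The two bounds required of \<open>f\<close> say that \<open>f\<close> is dominated by the sublinear functional \<open>r\<close>
  of the proof.
\<close>
lemma convex_subgradient:
  fixes F :: "'v::real_normed_vector \<Rightarrow> real"
  assumes D: "convex D" and F: "convex_on D F" and z: "z \<in> D" and c: "0 \<le> c"
    and min: "\<And>x. x \<in> D \<Longrightarrow> F z - F x \<le> c * norm (x - z)"
  obtains f where "linear f" "\<And>x. f x \<le> c * norm x" "\<And>x. x \<in> D \<Longrightarrow> F z + f (x - z) \<le> F x"
proof -
  define I where "I = {0::real..} \<times> D"
  \<comment> \<open>\<open>r\<close> is the infimal convolution of c times the norm with the cone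
    generated by the increments of \<open>F\<close> at z. The choice l = 0 bounds \<open>r\<close>
    by c times the norm, and l = 1 with v = x - z bounds it by F x - F z; the hypothesis
    \<open>min\<close> keeps it finite.\<close>
  define G where "G v = (\<lambda>(l, x). c * norm (v - l *\<^sub>R (x - z)) + l * (F x - F z))" for v
  define r where "r v = (INF i\<in>I. G v i)" for v
  have lb: "- (c * norm v) \<le> G v i" if iI: "i \<in> I" for v i
  proof -
    obtain l x where i: "i = (l, x)" "0 \<le> l" "x \<in> D" using iI unfolding I_def by blast
    have "l * (F z - F x) \<le> l * (c * norm (x - z))" using min[OF i(3)] i(2) by (rule mult_left_mono)
    also have "\<dots> = c * norm (l *\<^sub>R (x - z))" using i(2) by simp
    also have "\<dots> \<le> c * (norm (v - l *\<^sub>R (x - z)) + norm v)"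
      using mult_left_mono[OF norm_triangle_sub[of "l *\<^sub>R (x - z)" v] c]
      by (simp add: norm_minus_commute add.commute)
    finally show ?thesis by (simp add: G_def i algebra_simps)
  qed
  have bdd: "bdd_below (G v ` I)" for v
    by (rule bdd_belowI[of _ "- (c * norm v)"]) (use lb in auto)
  have le: "r v \<le> c * norm (v - l *\<^sub>R (x - z)) + l * (F x - F z)" if "0 \<le> l" "x \<in> D" for v l x
    using cINF_lower[OF bdd, of "(l, x)" v] that unfolding r_def by (simp add: I_def G_def)
  have Ine: "I \<noteq> {}" using z by (auto simp: I_def)
  have ge: "a \<le> r v" if "\<And>i. i \<in> I \<Longrightarrow> a \<le> G v i" for a v
    unfolding r_def by (rule cINF_greatest[OF Ine that])
  have "sublinear r"
  proof (rule sublinearI)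
    fix u v
    have *: "r (u + v) \<le> G u i + G v j" if ij: "i \<in> I" "j \<in> I" for i j
    proof -
      obtain l x m y where ij: "i = (l, x)" "j = (m, y)" and lm: "0 \<le> l" "0 \<le> m" and xy: "x \<in> D" "y \<in> D"
        using ij unfolding I_def by blast
      show ?thesis
      proof (cases "l + m = 0")
        case True
        then have "l = 0" "m = 0" using lm by auto
        then show ?thesis
          using le[of 0 z "u + v"] z mult_left_mono[OF norm_triangle_ineq c, of u v]
          by (simp add: G_def ij algebra_simps)
      next
        case False
        then have s: "0 < l + m" using lm by auto
        \<comment> \<open>The weight makes (l + m) (w - z) equal to l (x - z) + m (y - z), so the
          pair (l + m, w) is a competitor for the sum u + v.\<close>
        define t where "t = m / (l + m)"
        have t: "0 \<le> t" "t \<le> 1" "(l + m) * t = m" "(l + m) * (1 - t) = l"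
          using s lm by (auto simp: t_def field_simps)
        define w where "w = (1 - t) *\<^sub>R x + t *\<^sub>R y"
        have w: "w \<in> D" unfolding w_def using convexD_alt[OF D xy t(1,2)] .
        have "F w \<le> (1 - t) * F x + t * F y" unfolding w_def
          using convex_onD[OF F t(1,2) xy] .
        then have "(l + m) * (F w - F z) \<le> (l + m) * ((1 - t) * F x + t * F y - F z)"
          using s by simp
        also have "\<dots> = ((l + m) * (1 - t)) * F x + ((l + m) * t) * F y - (l + m) * F z"
          by (simp add: algebra_simps)
        finally have Fw: "(l + m) * (F w - F z) \<le> l * (F x - F z) + m * (F y - F z)"
          by (simp only: t) (simp add: algebra_simps)
        have "(l + m) *\<^sub>R (w - z) = ((l + m) * (1 - t)) *\<^sub>R x + ((l + m) * t) *\<^sub>R y - (l + m) *\<^sub>R z"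
          by (simp add: w_def algebra_simps)
        then have "u + v - (l + m) *\<^sub>R (w - z) = (u - l *\<^sub>R (x - z)) + (v - m *\<^sub>R (y - z))"
          by (simp only: t) (simp add: algebra_simps)
        then have "c * norm (u + v - (l + m) *\<^sub>R (w - z)) \<le>
            c * (norm (u - l *\<^sub>R (x - z)) + norm (v - m *\<^sub>R (y - z)))"
          using norm_triangle_ineq mult_left_mono[OF _ c] by metis
        then show ?thesis
          using le[OF _ w, of "l + m" "u + v"] s Fw by (simp add: G_def ij algebra_simps)
      qed
    qed
    have "r (u + v) - r v \<le> G u i" if "i \<in> I" for i
    proof -
      have "r (u + v) - G u i \<le> r v" by (rule ge) (use *[OF that] in \<open>auto simp: algebra_simps\<close>)
      then show ?thesis by simp
    qed
    from ge[OF this] show "r (u + v) \<le> r u + r v" by simp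
  next
    fix a :: real and v :: 'v assume a: "0 < a"
    have "inverse a * r (a *\<^sub>R v) \<le> G v i" if iI: "i \<in> I" for i
    proof -
      obtain l x where i: "i = (l, x)" "0 \<le> l" "x \<in> D" using iI unfolding I_def by blast
      have "r (a *\<^sub>R v) \<le> c * norm (a *\<^sub>R (v - l *\<^sub>R (x - z))) + a * (l * (F x - F z))"
        using le[of "a * l" x "a *\<^sub>R v"] i a by (simp add: scaleR_diff_right)
      also have "\<dots> = a * G v i"
        unfolding norm_scaleR G_def i prod.case using a by (simp add: distrib_left mult.left_commute)
      finally show ?thesis using a by (simp add: field_simps)
    qed
    from ge[OF this] show "r (a *\<^sub>R v) \<le> a * r v" using a by (simp add: field_simps)
  next
    show "r 0 = 0" using le[of 0 z 0] z ge[of 0 0] lb[of _ 0] by fastforce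
  qed
  from dominated_functional_exists[OF this] obtain f where f: "linear f" "\<And>x. f x \<le> r x" by blast
  show thesis
  proof (rule that[OF f(1)])
    show "f x \<le> c * norm x" for x using f(2)[of x] le[of 0 z x] z by simp
    show "F z + f (x - z) \<le> F x" if "x \<in> D" for x
      using f(2)[of "x - z"] le[of 1 x "x - z"] that by simp
  qed
qed

text \<open>
  This replaces Milman's partial converse of the Krein--Milman theorem: if the functionals below
  \<open>P\<close> are the convex hull of two pieces, each extreme one lies in one of the pieces.
\<close>
lemma extreme_le_max:
  fixes f p q P :: "'v::real_normed_vector \<Rightarrow> real"
  assumes f: "linear f" and p: "sublinear p" and q: "sublinear q"
    and ext: "\<And>g h u. linear g \<Longrightarrow> linear h \<Longrightarrow> (\<And>x. g x \<le> P x) \<Longrightarrow> (\<And>x. h x \<le> P x) \<Longrightarrow>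
       0 < u \<Longrightarrow> u < 1 \<Longrightarrow> (\<And>x. f x = (1 - u) * g x + u * h x) \<Longrightarrow> g = f \<and> h = f"
    and pP: "\<And>x. p x \<le> P x" and qP: "\<And>x. q x \<le> P x"
    and le: "\<And>x. f x \<le> max (p x) (q x)"
  shows "(\<forall>x. f x \<le> p x) \<or> (\<forall>x. f x \<le> q x)"
proof -
  \<comment> \<open>The aim is to split \<open>f\<close> as g + (f - g) with g below t p and f - g
    below (1 - t) q for a common weight t. The additional real coordinate encodes the unknown
    weight: it becomes the value of the dominated functional at (0, 1).\<close>
  define G where "G v y = max (p (fst v + y) + snd v) (q y) - f y" for v :: "'v \<times> real" and y
  define r where "r v = (INF y. G v y)" for v
  have lb: "- \<bar>p (- fst v)\<bar> - \<bar>snd v\<bar> \<le> G v y" for v y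
    using le[of y] sublinear_add[OF p, of "fst v + y" "- fst v"] unfolding G_def by (simp add: algebra_simps)
  have bdd: "bdd_below (range (G v))" for v
    by (rule bdd_belowI[of _ "- \<bar>p (- fst v)\<bar> - \<bar>snd v\<bar>"]) (use lb in blast)
  have rle: "r v \<le> G v y" for v y
    unfolding r_def by (rule cINF_lower[OF bdd]) auto
  have ge: "a \<le> r v" if "\<And>y. a \<le> G v y" for a v
    unfolding r_def by (rule cINF_greatest) (use that in auto)
  have "sublinear r"
  proof (rule sublinearI)
    fix u v
    have *: "r (u + v) \<le> G u x + G v y" for x y
    proof -
      have "p (fst u + fst v + (x + y)) \<le> p (fst u + x) + p (fst v + y)"
        using sublinear_add[OF p, of "fst u + x" "fst v + y"] by (simp add: algebra_simps)
      then have "G (u + v) (x + y) \<le> G u x + G v y"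
        using sublinear_add[OF q, of x y] linear_add[OF f, of x y] unfolding G_def fst_add snd_add
        by linarith
      then show ?thesis using rle order_trans by blast
    qed
    have "r (u + v) - r v \<le> G u x" for x
    proof -
      have "r (u + v) - G u x \<le> r v" by (rule ge) (use *[of x] in \<open>auto simp: algebra_simps\<close>)
      then show ?thesis by simp
    qed
    from ge[OF this] show "r (u + v) \<le> r u + r v" by simp
  next
    fix a :: real and v :: "'v \<times> real" assume a: "0 < a"
    have "inverse a * r (a *\<^sub>R v) \<le> G v y" for y
    proof -
      have "p (a *\<^sub>R fst v + a *\<^sub>R y) = a * p (fst v + y)"
        using sublinear_scale[OF p, of a "fst v + y"] a by (simp add: scaleR_add_right)
      moreover have "q (a *\<^sub>R y) = a * q y" using sublinear_scale[OF q] a by simp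
      ultimately have "G (a *\<^sub>R v) (a *\<^sub>R y) = a * G v y"
        using a max_mult_distrib_left[of a "p (fst v + y) + snd v" "q y"]
        by (simp add: G_def linear_scale[OF f] right_diff_distrib distrib_left)
      then show ?thesis using rle[of "a *\<^sub>R v" "a *\<^sub>R y"] a by (simp add: field_simps)
    qed
    from ge[OF this] show "r (a *\<^sub>R v) \<le> a * r v" using a by (simp add: field_simps)
  next
    have "0 \<le> r 0" by (rule ge) (use lb[of 0] sublinear_zero[OF p] in auto)
    moreover have "r 0 \<le> 0"
      using rle[of 0 0] by (simp add: G_def sublinear_zero[OF p] sublinear_zero[OF q] linear_0[OF f])
    ultimately show "r 0 = 0" by simp
  qed
  from dominated_functional_exists[OF this] obtain k where k: "linear k" "\<And>v. k v \<le> r v" by blast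
  define t where "t = k (0, 1)"
  define g where "g x = k (x, 0)" for x
  have k_eq: "k (x, s) = g x + s * t" for x s
    using linear_add[OF k(1), of "(x, 0)" "s *\<^sub>R (0, 1)"] linear_scale[OF k(1), of s "(0, 1)"]
    by (simp add: g_def t_def)
  have k_le: "g x + s * t \<le> max (p (x + y) + s) (q y) - f y" for x s y
    using k(2)[of "(x, s)"] rle[of "(x, s)" y] by (simp add: k_eq G_def)
  have g: "linear g"
    unfolding g_def using linear_compose[of "\<lambda>x. (x, 0)" k] k(1)
    by (simp add: o_def linear_iff)
  \<comment> \<open>The offset s = - p x makes the first entry of the maximum vanish at y = 0. In
    \<open>gq\<close> the point - y cancels the argument of p, and s = q y makes both entries equal;
    the offsets 1 and - 1 at the origin then confine t to the unit interval.\<close>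
  have gp: "g x \<le> t * p x" for x
    using k_le[of x "- p x" 0] by (simp add: sublinear_zero[OF q] linear_0[OF f] algebra_simps)
  have gq: "f y - g y \<le> (1 - t) * q y" for y
    using k_le[of "- y" "q y" y]
    by (simp add: sublinear_zero[OF p] linear_neg[OF g] algebra_simps)
  have t: "0 \<le> t" "t \<le> 1"
    using k_le[of 0 1 0] k_le[of 0 "- 1" 0]
    by (simp_all add: sublinear_zero[OF p] sublinear_zero[OF q] linear_0[OF f] linear_0[OF g])
  consider "t = 0" | "t = 1" | "0 < t" "t < 1" using t by linarith
  then show ?thesis
  proof cases
    case 1
    then have "g x = 0" for x using gp[of x] gp[of "- x"] by (simp add: linear_neg[OF g])
    then show ?thesis using gq 1 by simp
  next
    case 2
    have fg: "linear (\<lambda>x. f x - g x)" using f g by (rule linear_compose_sub)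
    have "f x - g x = 0" for x
      using gq[of x] gq[of "- x"] 2 by (simp add: linear_neg[OF f] linear_neg[OF g])
    then show ?thesis using gp 2 by auto
  next
    case 3
    let ?g = "\<lambda>x. (f x - g x) / (1 - t)" and ?h = "\<lambda>x. g x / t"
    have "linear ?g" "linear ?h"
      using f g by (auto simp: linear_iff add_divide_distrib diff_divide_distrib algebra_simps)
    moreover have hp: "?h x \<le> p x" for x using gp[of x] 3 by (simp add: field_simps)
    moreover have "?g x \<le> q x" for x using gq[of x] 3 by (simp add: divide_le_eq mult.commute)
    moreover have "f x = (1 - t) * ?g x + t * ?h x" for x using 3 by simp
    ultimately have "?h = f" using ext[of ?g ?h t] 3 pP qP by (meson order_trans)
    then show ?thesis using hp by metis
  qed
qed

lemma extreme_le_Max: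
  fixes f P :: "'v::real_normed_vector \<Rightarrow> real"
  assumes f: "linear f"
    and ext: "\<And>g h u. linear g \<Longrightarrow> linear h \<Longrightarrow> (\<And>x. g x \<le> P x) \<Longrightarrow> (\<And>x. h x \<le> P x) \<Longrightarrow>
       0 < u \<Longrightarrow> u < 1 \<Longrightarrow> (\<And>x. f x = (1 - u) * g x + u * h x) \<Longrightarrow> g = f \<and> h = f"
    and N: "finite N" "N \<noteq> {}"
    and p: "\<And>i. i \<in> N \<Longrightarrow> sublinear (p i)" "\<And>i x. i \<in> N \<Longrightarrow> p i x \<le> P x"
    and le: "\<And>x. f x \<le> Max ((\<lambda>i. p i x) ` N)"
  shows "\<exists>i\<in>N. \<forall>x. f x \<le> p i x"
proof -
  \<comment> \<open>The first two conjuncts belong to the induction because the two-piece lemma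
    needs the maximum of the remaining pieces to be sublinear and below \<open>P\<close>.\<close>
  have "sublinear (\<lambda>x. Max ((\<lambda>i. p i x) ` N)) \<and> (\<forall>x. Max ((\<lambda>i. p i x) ` N) \<le> P x) \<and>
      ((\<forall>x. f x \<le> Max ((\<lambda>i. p i x) ` N)) \<longrightarrow> (\<exists>i\<in>N. \<forall>x. f x \<le> p i x))"
    using N p
  proof (induction N rule: finite_ne_induct)
    case (singleton i)
    then show ?case by auto
  next
    case (insert i N)
    let ?q = "\<lambda>x. Max ((\<lambda>i. p i x) ` N)"
    have eq: "Max ((\<lambda>i. p i x) ` insert i N) = max (p i x) (?q x)" for x
      using insert.hyps by simp
    have q: "sublinear ?q" "\<forall>x. ?q x \<le> P x"
      and IH: "(\<forall>x. f x \<le> ?q x) \<Longrightarrow> \<exists>i\<in>N. \<forall>x. f x \<le> p i x"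
      using insert by auto
    have i: "sublinear (p i)" "\<forall>x. p i x \<le> P x" using insert.prems by auto
    have "\<exists>j\<in>insert i N. \<forall>x. f x \<le> p j x" if "\<forall>x. f x \<le> max (p i x) (?q x)"
    proof -
      have "(\<forall>x. f x \<le> p i x) \<or> (\<forall>x. f x \<le> ?q x)"
        by (rule extreme_le_max[where P=P, OF f i(1) q(1) ext]) (use i(2) q(2) that in auto)
      then show ?thesis using IH by blast
    qed
    then show ?case unfolding eq using sublinear_max[OF i(1) q(1)] i(2) q(2) by simp
  qed
  then show ?thesis using le by blast
qed

subsection \<open>Stegall's variational principle\<close>

text \<open>The relation "y belongs to \<open>S u\<close>" is a partial order. A sequence that
  descends in it and almost minimizes \<open>F\<close> over each successive \<open>S (X n)\<close>
  makes these sets shrink to a point. That point z lies in all of them because \<open>lsc\<close>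
  makes them closed, and a y violating the last inequality would lie in all of them too, hence equal
  z.\<close>

theorem ekeland:
  fixes F :: "'a::metric_space \<Rightarrow> real"
  assumes D: "complete D" and x: "x \<in> D" and c: "0 < c"
    and lsc: "\<And>u r. closed {y \<in> D. F y + c * dist y u \<le> r}"
    and bound: "\<And>y. y \<in> D \<Longrightarrow> m \<le> F y"
  obtains z where "z \<in> D" "F z + c * dist z x \<le> F x" "\<And>y. y \<in> D \<Longrightarrow> F z - F y \<le> c * dist y z"
proof -
  define S where "S u = {y \<in> D. F y + c * dist y u \<le> F u}" for u
  have S_self: "u \<in> S u" if "u \<in> D" for u using that by (simp add: S_def)
  have S_trans: "S v \<subseteq> S u" if "v \<in> S u" for u v
  proof
    fix y assume "y \<in> S v"
    moreover have "c * dist y u \<le> c * (dist y v + dist v u)"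
      using c by (simp add: dist_triangle)
    ultimately show "y \<in> S u" using that by (auto simp: S_def algebra_simps)
  qed
  have ex: "\<exists>v. v \<in> D \<and> v \<in> S u \<and> (\<forall>y\<in>S u. F v \<le> F y + (1/2) ^ n)" if uD: "u \<in> D" for u n
  proof -
    have bdd: "bdd_below (F ` S u)" using bound by (auto simp: S_def intro!: bdd_belowI[of _ m])
    obtain v where "v \<in> S u" "F v < (INF y\<in>S u. F y) + (1/2) ^ n"
      using cINF_less_iff[OF _ bdd, of "(INF y\<in>S u. F y) + (1/2) ^ n"] S_self[OF uD] by auto
    moreover have "(INF y\<in>S u. F y) \<le> F y" if "y \<in> S u" for y
      by (rule cINF_lower[OF bdd that])
    ultimately show ?thesis by (intro exI[of _ v]) (fastforce simp: S_def)
  qed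
  define g where "g n u = (SOME v. v \<in> D \<and> v \<in> S u \<and> (\<forall>y\<in>S u. F v \<le> F y + (1/2) ^ n))" for n :: nat and u
  have g: "g n u \<in> D \<and> g n u \<in> S u \<and> (\<forall>y\<in>S u. F (g n u) \<le> F y + (1/2) ^ n)" if "u \<in> D" for u n
    unfolding g_def by (rule someI_ex[OF ex[OF that]])
  define X where "X = rec_nat x g"
  have X_Suc: "X (Suc n) = g n (X n)" for n by (simp add: X_def)
  have XD: "X n \<in> D" for n by (induction n) (use x g in \<open>auto simp: X_def\<close>)
  have X_step: "X (Suc n) \<in> S (X n)" and X_min: "\<And>y. y \<in> S (X n) \<Longrightarrow> F (X (Suc n)) \<le> F y + (1/2) ^ n" for n
    using g[OF XD[of n]] by (auto simp: X_Suc)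
  have S_dec: "S (X n) \<subseteq> S (X k)" if "k \<le> n" for k n
    using that by (induction n rule: dec_induct) (use S_trans[OF X_step] in auto)
  have near: "c * dist y (X (Suc n)) \<le> (1/2) ^ n" if "y \<in> S (X (Suc n))" for y n
    using X_min[of y n] S_dec[of n "Suc n"] that by (auto simp: S_def)
  have lim0: "(\<lambda>n. (1/2) ^ n / c :: real) \<longlonglongrightarrow> 0"
    by (intro tendsto_divide_zero LIMSEQ_power_zero) auto
  have dist0: "(\<lambda>n. dist y (X (Suc n))) \<longlonglongrightarrow> 0" if "\<And>n. y \<in> S (X n)" for y
    by (rule tendsto_sandwich[OF _ _ tendsto_const lim0])
      (use near[OF that] c in \<open>auto simp: field_simps\<close>)
  have XS: "X n \<in> S (X k)" if "k \<le> n" for k n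
    using S_dec[OF that] S_self[OF XD] by blast
  have "Cauchy X"
  proof (rule metric_CauchyI)
    fix e :: real assume e: "0 < e"
    have "(\<lambda>n. (1/2) ^ n / c :: real) \<longlonglongrightarrow> 0" by (rule lim0)
    then have "\<forall>\<^sub>F n in sequentially. (1/2) ^ n / c < e / 2"
      by (rule order_tendstoD) (use e in auto)
    then obtain n where n: "(1/2) ^ n / c < e / 2" by (auto simp: eventually_sequentially)
    have *: "dist (X k) (X (Suc n)) < e / 2" if "k \<ge> Suc n" for k
    proof -
      have "dist (X k) (X (Suc n)) \<le> (1/2) ^ n / c" using near[OF XS[OF that]] c by (simp add: field_simps)
      then show ?thesis using n by (rule le_less_trans)
    qed
    show "\<exists>M. \<forall>k\<ge>M. \<forall>l\<ge>M. dist (X k) (X l) < e"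
      using * by (intro exI[of _ "Suc n"]) (metis dist_triangle_half_l)
  qed
  then obtain z where zD: "z \<in> D" and z: "X \<longlonglongrightarrow> z"
    using D XD unfolding complete_def by blast
  have zS: "z \<in> S (X k)" for k
  proof -
    have "closed (S (X k))" unfolding S_def by (rule lsc)
    then show ?thesis
      by (rule Lim_in_closed_set[OF _ _ _ z])
        (use XS in \<open>auto simp: eventually_sequentially\<close>)
  qed
  show thesis
  proof (rule that[OF zD])
    show "F z + c * dist z x \<le> F x" using zS[of 0] by (simp add: S_def X_def)
    show "F z - F y \<le> c * dist y z" if "y \<in> D" for y
    proof (rule ccontr)
      assume *: "\<not> ?thesis"
      then have "y \<in> S z" using that by (simp add: S_def)
      then have "\<And>n. y \<in> S (X n)" using S_trans[OF zS] by blast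
      then have "(\<lambda>n. X (Suc n)) \<longlonglongrightarrow> y"
        by (subst tendsto_dist_iff, subst dist_commute) (rule dist0)
      then have "y = z" using LIMSEQ_unique[OF _ LIMSEQ_Suc[OF z]] by simp
      then show False using * by simp
    qed
  qed
qed

text \<open>An error of \<open>d\<^sup>2\<close> is spent as a distance d at slope d. Ekeland's
  inequality at z is the growth condition of \<open>convex_subgradient\<close>, whose functional
  turns z into an exact minimizer of the tilted function.\<close>

lemma bronsted_rockafellar:
  fixes F :: "'a::banach \<Rightarrow> real"
  assumes D: "closed D" "convex D" and F: "convex_on D F"
    and lsc: "\<And>c u r. 0 < c \<Longrightarrow> closed {y \<in> D. F y + c * dist y u \<le> r}"
    and x: "x \<in> D" and d: "0 < d" and almost: "\<And>y. y \<in> D \<Longrightarrow> F x \<le> F y + d\<^sup>2"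
  obtains z f where "z \<in> D" "dist z x \<le> d" "norm (f :: 'a \<Rightarrow>\<^sub>L real) \<le> d"
    "\<And>y. y \<in> D \<Longrightarrow> F z - f z \<le> F y - f y"
proof -
  obtain z where z: "z \<in> D" "F z + d * dist z x \<le> F x" "\<And>y. y \<in> D \<Longrightarrow> F z - F y \<le> d * dist y z"
  proof (rule ekeland[where D=D and x=x and c=d and F=F and m="F x - d\<^sup>2"])
    show "complete D" using D(1) by (simp add: complete_eq_closed)
    show "F x - d\<^sup>2 \<le> F y" if "y \<in> D" for y using almost[OF that] by simp
  qed (use x d lsc in auto)
  obtain f where f: "linear f" "\<And>x. f x \<le> d * norm x" "\<And>x. x \<in> D \<Longrightarrow> F z + f (x - z) \<le> F x"
    by (rule convex_subgradient[OF D(2) F z(1), of d]) (use z(3) d in \<open>auto simp: dist_norm\<close>)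
  have abs: "norm (f x) \<le> norm x * d" for x
    using f(2)[of x] f(2)[of "- x"] linear_neg[OF f(1), of x] by (simp add: abs_le_iff mult.commute)
  then have "bounded_linear f"
    using f(1) by (auto simp: bounded_linear_def bounded_linear_axioms_def)
  note bf = bounded_linear_Blinfun_apply[OF this]
  show thesis
  proof (rule that[of z "Blinfun f"])
    have "d * dist z x \<le> d * d" using z(2) almost[OF z(1)] by (simp add: power2_eq_square)
    then show "dist z x \<le> d" using d by simp
    show "norm (Blinfun f) \<le> d"
      by (rule norm_blinfun_bound) (use d abs in \<open>auto simp: bf mult.commute\<close>)
    show "F z - blinfun_apply (Blinfun f) z \<le> F y - blinfun_apply (Blinfun f) y" if "y \<in> D" for y
      using f(3)[OF that] by (simp add: bf linear_diff[OF f(1)])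
  qed (rule z(1))
qed

section \<open>Slices, dentability and generic linear perturbations\<close>

definition slice :: "'a set \<Rightarrow> ('a \<Rightarrow> real) \<Rightarrow> real \<Rightarrow> 'a set"
  where "slice D F a = {x \<in> D. (SUP y\<in>D. F y) - a < F x}"

definition has_small_slice :: "'a::metric_space set \<Rightarrow> ('a \<Rightarrow> real) \<Rightarrow> real \<Rightarrow> bool"
  where "has_small_slice D F e \<longleftrightarrow> (\<exists>a>0. \<forall>x\<in>slice D F a. \<forall>y\<in>slice D F a. dist x y \<le> e)"

text \<open>The only form in which the Radon-Nikodym property enters the variational principle. The
  sets are neither closed nor convex in general, since the condition is applied to a set of
  minimizers.\<close>

definition all_dentable :: "'a::real_normed_vector itself \<Rightarrow> bool"
  where "all_dentable _ \<longleftrightarrow> (\<forall>(A :: 'a set) e. A \<noteq> {} \<longrightarrow> bounded A \<longrightarrow> 0 < e \<longrightarrow>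
    (\<exists>f :: 'a \<Rightarrow>\<^sub>L real. has_small_slice A (blinfun_apply f) e))"

lemma bdd_above_blinfun_image:
  fixes f :: "'a::real_normed_vector \<Rightarrow>\<^sub>L real"
  assumes "bounded A"
  shows "bdd_above (blinfun_apply f ` A)"
  using bounded_linear_image[OF assms blinfun.bounded_linear_right] by (rule bounded_imp_bdd_above)

lemma blinfun_abs_le: "\<bar>blinfun_apply f x\<bar> \<le> norm f * norm x"
  for f :: "'a::real_normed_vector \<Rightarrow>\<^sub>L real"
  using norm_blinfun[of f x] by simp

text \<open>
  The set \<open>A\<close> of exact minimizers of \<open>h - w\<close> for \<open>w\<close> near \<open>w0\<close> has a small slice, given by \<open>f\<close>
  say. Moving \<open>w\<close> a little in the direction \<open>f\<close> pushes all minimizers into this slice, and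
  almost minimizers are close to \<open>A\<close> by the Bronsted--Rockafellar lemma.
\<close>
lemma small_slice_convex:
  fixes h :: "'a::banach \<Rightarrow> real"
  assumes dent: "all_dentable TYPE('a)"
    and D: "closed D" "convex D" "bounded D" "D \<noteq> {}" and h: "convex_on D h"
    and lsc: "\<And>w c u r. 0 < c \<Longrightarrow> closed {y \<in> D. h y - blinfun_apply w y + c * dist y u \<le> r}"
    and bound: "\<And>y. y \<in> D \<Longrightarrow> m \<le> h y"
    and e: "0 < e" and eta: "0 < eta"
  obtains w where "norm (w - w0) < e" "has_small_slice D (\<lambda>x. blinfun_apply w x - h x) eta"
proof -
  have convex: "convex_on D (\<lambda>x. h x - blinfun_apply w x)" for w :: "'a \<Rightarrow>\<^sub>L real"
  proof -
    have "concave_on D (blinfun_apply w)"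
      using D(2) by (auto simp: concave_on_iff blinfun.add_right blinfun.scaleR_right)
    then show ?thesis by (rule convex_on_diff[OF h])
  qed
  have bdd: "bdd_above ((\<lambda>x. blinfun_apply w x - h x) ` D)" for w :: "'a \<Rightarrow>\<^sub>L real"
  proof -
    obtain M where "\<And>x. x \<in> D \<Longrightarrow> blinfun_apply w x \<le> M"
      using bdd_above_blinfun_image[OF D(3), of w] by (auto simp: bdd_above_def)
    then show ?thesis using bound by (intro bdd_aboveI[of _ "M - m"]) (auto simp: diff_mono)
  qed
  define A where "A = {z \<in> D. \<exists>w. norm (w - w0) < e \<and>
    (\<forall>y\<in>D. blinfun_apply w y - h y \<le> blinfun_apply w z - h z)}"
  have close: "\<exists>z\<in>A. dist z x \<le> d"
    if w: "norm (w - w0) + d < e" and d: "0 < d" and x: "x \<in> slice D (\<lambda>x. blinfun_apply w x - h x) (d\<^sup>2)"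
    for w x d
  proof -
    have almost: "h x - blinfun_apply w x \<le> h y - blinfun_apply w y + d\<^sup>2" if "y \<in> D" for y
      using cSUP_upper[OF that bdd, of w] x by (simp add: slice_def)
    obtain z f where z: "z \<in> D" "dist z x \<le> d" and f: "norm (f :: 'a \<Rightarrow>\<^sub>L real) \<le> d"
      and min: "\<And>y. y \<in> D \<Longrightarrow> h z - blinfun_apply w z - f z \<le> h y - blinfun_apply w y - f y"
    proof (rule bronsted_rockafellar[OF D(1,2) convex[of w] lsc _ d])
      show "x \<in> D" using x by (simp add: slice_def)
    qed (use almost in auto)
    \<comment> \<open>The tilt \<open>f\<close> has norm at most d, and the assumption on w and d
      leaves room for it, so z minimizes exactly for an admissible functional.\<close>
    have "norm (w + f - w0) < e"
      using norm_triangle_ineq[of "w - w0" f] w f by (simp add: algebra_simps)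
    then have "z \<in> A"
      unfolding A_def using z(1) min
      by (auto simp: blinfun.add_left intro!: exI[of _ "w + f"]) (smt (verit))
    then show ?thesis using z(2) by blast
  qed
  have ne: "slice D (\<lambda>x. blinfun_apply w x - h x) a \<noteq> {}" if "0 < a" for w a
    using less_cSUP_iff[OF D(4) bdd, of "(SUP x\<in>D. blinfun_apply w x - h x) - a" w] that
    by (auto simp: slice_def)
  obtain x where "x \<in> slice D (\<lambda>x. blinfun_apply w0 x - h x) ((e/2)\<^sup>2)"
    using ne[of "(e/2)\<^sup>2" w0] e by auto
  then have "A \<noteq> {}" using close[of w0 "e/2" x] e by auto
  moreover have "bounded A" by (rule bounded_subset[OF D(3)]) (auto simp: A_def)
  ultimately obtain f :: "'a \<Rightarrow>\<^sub>L real" and b where b: "0 < b"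
    and small: "\<And>x y. x \<in> slice A f b \<Longrightarrow> y \<in> slice A f b \<Longrightarrow> dist x y \<le> eta / 2"
    using dent eta unfolding all_dentable_def has_small_slice_def by (meson half_gt_zero)
  define s where "s = (SUP y\<in>A. f y)"
  have "s - b / 2 < (SUP y\<in>A. f y)" using b by (simp add: s_def)
  then obtain z where z: "z \<in> A" "s - b / 2 < f z"
    using less_cSUP_iff[OF \<open>A \<noteq> {}\<close> bdd_above_blinfun_image[OF \<open>bounded A\<close>]] by blast
  then obtain w where w: "norm (w - w0) < e"
    and wz: "\<And>y. y \<in> D \<Longrightarrow> blinfun_apply w y - h y \<le> blinfun_apply w z - h z" and zD: "z \<in> D"
    unfolding A_def by blast
  \<comment> \<open>The step in the direction \<open>f\<close> uses at most half of the room left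
    between w and the sphere of radius e about w0. The 1 in the denominator covers f = 0.\<close>
  define t where "t = (e - norm (w - w0)) / (2 * (norm f + 1))"
  have f1: "0 < norm f + 1" by (rule add_nonneg_pos) auto
  then have t: "0 < t" using w by (simp add: t_def)
  have "t * norm f \<le> t * (norm f + 1)" using t by simp
  also have "\<dots> = (e - norm (w - w0)) / 2"
    unfolding t_def using f1 by (simp add: field_simps)
  finally have tf: "t * norm f \<le> (e - norm (w - w0)) / 2" .
  define v where "v = w + t *\<^sub>R f"
  have "norm (v - w0) \<le> norm (w - w0) + t * norm f"
    using norm_triangle_ineq[of "w - w0" "t *\<^sub>R f"] t by (simp add: v_def algebra_simps)
  then have v: "norm (v - w0) < e" using tf w by argo
  define q where "q = 1 / t + norm f"
  have q: "0 < q" using t by (simp add: q_def add_pos_nonneg)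
  \<comment> \<open>The bounds in turn: \<open>d \<le> 1\<close> gives
    \<open>d\<^sup>2 \<le> d\<close>; two approximations within eta / 4 add to the diameter eta / 2;
    d fits into the room left around v; and the errors \<open>d\<^sup>2 / t\<close> and
    \<open>norm f * d\<close> together stay below b / 4.\<close>
  define d where "d = min (min 1 (eta / 4)) (min ((e - norm (v - w0)) / 2) (b / (4 * q)))"
  have d: "0 < d" "d \<le> 1" "d \<le> eta / 4" "d \<le> (e - norm (v - w0)) / 2" "d \<le> b / (4 * q)"
    unfolding d_def using eta v b q by (auto simp del: le_divide_eq_numeral1 intro: min.coboundedI1 min.coboundedI2)
  have de: "norm (v - w0) + d < e" using d(4) v by argo
  have dq: "d\<^sup>2 / t + norm f * d \<le> b / 4"
  proof -
    have "d * q \<le> b / 4" using d(5) q by (simp add: field_simps)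
    moreover have "d\<^sup>2 / t \<le> d / t" using d(1,2) t by (auto simp: power2_eq_square intro!: divide_right_mono mult_left_le)
    moreover have "d * q = d / t + norm f * d" by (simp add: q_def algebra_simps)
    ultimately show ?thesis by linarith
  qed
  have near: "\<exists>y\<in>slice A f b. dist y x \<le> d" if x: "x \<in> slice D (\<lambda>x. blinfun_apply v x - h x) (d\<^sup>2)" for x
  proof -
    obtain y where y: "y \<in> A" "dist y x \<le> d" using close[OF de d(1) x] by blast
    have xD: "x \<in> D" using x by (simp add: slice_def)
    have "blinfun_apply v z - h z - d\<^sup>2 < blinfun_apply v x - h x"
      using x cSUP_upper[OF zD bdd, of v] by (simp add: slice_def)
    \<comment> \<open>Since z maximizes w - h, x can come close to z for v = w + t f only if t f x
      is almost as large as t f z.\<close>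
    then have "t * f z - d\<^sup>2 < t * f x"
      using wz[OF xD] by (simp add: v_def blinfun.add_left blinfun.scaleR_left)
    then have fx: "f z - d\<^sup>2 / t < f x" using t by (simp add: field_simps)
    have "\<bar>f (y - x)\<bar> \<le> norm f * d"
      using blinfun_abs_le[of f "y - x"] y(2) mult_left_mono[of "norm (y - x)" d "norm f"]
      by (simp add: dist_norm)
    then have "f x - norm f * d \<le> f y" by (simp add: blinfun.diff_right)
    then have "s - b < f y" using fx dq z(2) b by linarith
    then show ?thesis using y by (auto simp: slice_def s_def)
  qed
  have "dist x x' \<le> eta"
    if x: "x \<in> slice D (\<lambda>x. blinfun_apply v x - h x) (d\<^sup>2)" "x' \<in> slice D (\<lambda>x. blinfun_apply v x - h x) (d\<^sup>2)"
    for x x'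
  proof -
    obtain y y' where y: "y \<in> slice A f b" "dist y x \<le> d" "y' \<in> slice A f b" "dist y' x' \<le> d"
      using near x by meson
    have "dist x x' \<le> dist y x + dist y y' + dist y' x'"
      using dist_triangle[of x x' y] dist_triangle[of y x' y'] by (simp add: dist_commute)
    then show ?thesis using small[OF y(1,3)] y d(3) by linarith
  qed
  then have "has_small_slice D (\<lambda>x. blinfun_apply v x - h x) eta"
    unfolding has_small_slice_def using d(1) by (intro exI[of _ "d\<^sup>2"]) auto
  then show thesis using that v by blast
qed

text \<open>
  A bounded function is replaced by its concave envelope, the negative of \<open>h\<close> below; this does
  not change the suprema of linear perturbations and only enlarges their slices.
\<close>
lemma small_slice_dense:
  fixes \<psi> :: "'a::banach \<Rightarrow> real"
  assumes dent: "all_dentable TYPE('a)"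
    and D: "closed D" "convex D" "bounded D" "D \<noteq> {}" and psi: "bdd_above (\<psi> ` D)"
    and e: "0 < e" and eta: "0 < eta"
  obtains w where "norm (w - w0) < e" "has_small_slice D (\<lambda>x. \<psi> x + blinfun_apply w x) eta"
proof -
  \<comment> \<open>\<open>p\<close> is the convex conjugate of - \<psi> on \<open>D\<close> and
    \<open>h\<close> the conjugate of \<open>p\<close>, so \<open>h\<close> is the
    biconjugate.\<close>
  define p where "p w = (SUP x\<in>D. \<psi> x + blinfun_apply w x)" for w :: "'a \<Rightarrow>\<^sub>L real"
  define h where "h x = (SUP w. blinfun_apply w x - p w)" for x
  have bdd: "bdd_above ((\<lambda>x. \<psi> x + blinfun_apply w x) ` D)" for w :: "'a \<Rightarrow>\<^sub>L real"
  proof -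
    obtain M N where "\<And>x. x \<in> D \<Longrightarrow> blinfun_apply w x \<le> M" "\<And>x. x \<in> D \<Longrightarrow> \<psi> x \<le> N"
      using bdd_above_blinfun_image[OF D(3), of w] psi by (auto simp: bdd_above_def)
    then show ?thesis by (intro bdd_aboveI[of _ "N + M"]) (auto simp: add_mono)
  qed
  have p_ge: "\<psi> x + blinfun_apply w x \<le> p w" if "x \<in> D" for x w
    unfolding p_def by (rule cSUP_upper[OF that bdd])
  have bddh: "bdd_above (range (\<lambda>w. blinfun_apply w x - p w))" if "x \<in> D" for x
    using p_ge[OF that] by (intro bdd_aboveI[of _ "- \<psi> x"]) (auto simp: algebra_simps)
  have h_ge: "blinfun_apply w x - p w \<le> h x" if "x \<in> D" for x w
    unfolding h_def by (rule cSUP_upper[OF UNIV_I bddh[OF that]])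
  have h_le: "h x \<le> c" if "\<And>w. blinfun_apply w x - p w \<le> c" for x c
    unfolding h_def by (rule cSUP_least) (use that in auto)
  have h_le_iff: "h x \<le> c \<longleftrightarrow> (\<forall>w. blinfun_apply w x - p w \<le> c)" if "x \<in> D" for x c
    using h_le h_ge[OF that] by (meson order_trans)
  have h_psi: "h x \<le> - \<psi> x" if "x \<in> D" for x
    using p_ge[OF that] by (intro h_le) (simp add: algebra_simps)
  have convex: "convex_on D h"
  proof (rule convex_onI[OF _ D(2)])
    fix t :: real and x y assume t: "0 < t" "t < 1" and xy: "x \<in> D" "y \<in> D"
    show "h ((1 - t) *\<^sub>R x + t *\<^sub>R y) \<le> (1 - t) * h x + t * h y"
    proof (rule h_le)
      fix w :: "'a \<Rightarrow>\<^sub>L real"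
      have "(1 - t) * (blinfun_apply w x - p w) + t * (blinfun_apply w y - p w) \<le> (1 - t) * h x + t * h y"
        using t h_ge[OF xy(1), of w] h_ge[OF xy(2), of w] by (intro add_mono mult_left_mono) auto
      then show "blinfun_apply w ((1 - t) *\<^sub>R x + t *\<^sub>R y) - p w \<le> (1 - t) * h x + t * h y"
        by (simp add: blinfun.add_right blinfun.diff_right blinfun.scaleR_right algebra_simps)
    qed
  qed
  \<comment> \<open>As a supremum of continuous affine functions, \<open>h\<close> turns its
    sublevel condition into one closed condition for each functional v.\<close>
  have lsc: "closed {y \<in> D. h y - blinfun_apply w y + c * dist y u \<le> r}" for w c u r
  proof -
    have "{y \<in> D. h y - blinfun_apply w y + c * dist y u \<le> r} =
        D \<inter> (\<Inter>v. {y. blinfun_apply v y - p v \<le> r + blinfun_apply w y - c * dist y u})" (is "?L = ?R")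
    proof (rule set_eqI)
      show "y \<in> ?L \<longleftrightarrow> y \<in> ?R" for y
        using h_le_iff[of y "r + blinfun_apply w y - c * dist y u"] by (auto simp: algebra_simps)
    qed
    moreover have "closed ?R"
      by (intro closed_Int D(1) closed_INT ballI closed_Collect_le continuous_intros)
    ultimately show ?thesis by simp
  qed
  have lower: "- p 0 \<le> h x" if "x \<in> D" for x using h_ge[OF that, of 0] by simp
  obtain w where w: "norm (w - w0) < e" "has_small_slice D (\<lambda>x. blinfun_apply w x - h x) eta"
    by (rule small_slice_convex[OF dent D convex lsc lower e eta])
  have sub: "slice D (\<lambda>x. \<psi> x + blinfun_apply w x) a \<subseteq> slice D (\<lambda>x. blinfun_apply w x - h x) a" for a
  proof
    fix x assume x: "x \<in> slice D (\<lambda>x. \<psi> x + blinfun_apply w x) a"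
    then have xD: "x \<in> D" and "p w - a < \<psi> x + blinfun_apply w x" by (auto simp: slice_def p_def)
    moreover have "(SUP x\<in>D. blinfun_apply w x - h x) \<le> p w"
      using D(4) h_ge by (intro cSUP_least) (auto simp: algebra_simps)
    ultimately show "x \<in> slice D (\<lambda>x. blinfun_apply w x - h x) a"
      using h_psi[OF xD] by (simp add: slice_def)
  qed
  have "has_small_slice D (\<lambda>x. \<psi> x + blinfun_apply w x) eta"
    using w(2) sub unfolding has_small_slice_def by (meson subsetD)
  then show thesis using that w(1) by blast
qed

lemma Baire_banach:
  fixes U :: "nat \<Rightarrow> 'a::banach set"
  assumes "\<And>n. open (U n)" "\<And>n x e. 0 < e \<Longrightarrow> \<exists>y\<in>U n. dist y x < e" and W: "open W" "W \<noteq> {}"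
  obtains x where "x \<in> W" "\<And>n. x \<in> U n"
proof -
  have "closure (U n) = UNIV" for n using assms(2) by (auto simp: closure_approachable)
  then have "euclidean closure_of (\<Inter>(range U)) = topspace (euclidean :: 'a topology)"
    using assms(1) Met_TC.metric_Baire_category[where 'a='a, of "range U"]
    by (auto simp: complete_UNIV)
  then have "closure (\<Inter>(range U)) = UNIV" by simp
  then obtain x where "x \<in> W \<inter> \<Inter>(range U)"
    using W by (metis Int_UNIV_right ex_in_conv open_Int_closure_eq_empty)
  then show thesis using that by auto
qed

lemma maximizing_sequence:
  fixes F :: "'a \<Rightarrow> real"
  assumes "D \<noteq> {}" and bdd: "bdd_above (F ` D)"
  obtains X where "\<And>n::nat. X n \<in> D" "(\<lambda>n. F (X n)) \<longlonglongrightarrow> (SUP x\<in>D. F x)"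
proof -
  let ?s = "SUP x\<in>D. F x"
  have "\<exists>x\<in>D. ?s - inverse (Suc n) < F x" for n
    using less_cSUP_iff[OF assms, of "?s - inverse (Suc n)"] by simp
  then obtain X where X: "\<And>n. X n \<in> D" "\<And>n. ?s - inverse (Suc n) < F (X n)" by metis
  have "(\<lambda>n. ?s - inverse (Suc n)) \<longlonglongrightarrow> ?s - 0"
    by (intro tendsto_intros LIMSEQ_inverse_real_of_nat)
  then have "(\<lambda>n. ?s - inverse (Suc n)) \<longlonglongrightarrow> ?s" by simp
  then have "(\<lambda>n. F (X n)) \<longlonglongrightarrow> ?s"
    by (rule tendsto_sandwich[rotated 2, OF _ tendsto_const])
      (use X in \<open>auto intro!: always_eventually less_imp_le cSUP_upper[OF _ bdd]\<close>)
  with X(1) show thesis by (rule that)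
qed

text \<open>The perturbations that have a slice of diameter at most 1 / (n + 1) form an open dense
  set. By Baire some small w lies in all of these sets, and then any two maximizing sequences
  approach each other. No value at x is claimed, as \<psi> may be discontinuous.\<close>

theorem stegall:
  fixes \<psi> :: "'a::banach \<Rightarrow> real"
  assumes dent: "all_dentable TYPE('a)"
    and D: "closed D" "convex D" "bounded D" "D \<noteq> {}" and psi: "bdd_above (\<psi> ` D)" and e: "0 < e"
  obtains w x where "norm (w :: 'a \<Rightarrow>\<^sub>L real) < e" "x \<in> D"
    "\<forall>X. (\<forall>n. X n \<in> D) \<longrightarrow> (\<lambda>n. \<psi> (X n) + w (X n)) \<longlonglongrightarrow> (SUP x\<in>D. \<psi> x + w x) \<longrightarrow> X \<longlonglongrightarrow> x"
proof -
  define p where "p w = (SUP x\<in>D. \<psi> x + blinfun_apply w x)" for w :: "'a \<Rightarrow>\<^sub>L real"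
  define U where "U n = {w. has_small_slice D (\<lambda>x. \<psi> x + blinfun_apply w x) (inverse (Suc n))}" for n
  have bdd: "bdd_above ((\<lambda>x. \<psi> x + blinfun_apply w x) ` D)" for w :: "'a \<Rightarrow>\<^sub>L real"
  proof -
    obtain M N where "\<And>x. x \<in> D \<Longrightarrow> blinfun_apply w x \<le> M" "\<And>x. x \<in> D \<Longrightarrow> \<psi> x \<le> N"
      using bdd_above_blinfun_image[OF D(3), of w] psi by (auto simp: bdd_above_def)
    then show ?thesis by (intro bdd_aboveI[of _ "N + M"]) (auto simp: add_mono)
  qed
  have p_ge: "\<psi> x + blinfun_apply w x \<le> p w" if "x \<in> D" for x w
    unfolding p_def by (rule cSUP_upper[OF that bdd])
  obtain R where R: "0 < R" "\<And>x. x \<in> D \<Longrightarrow> norm x \<le> R" using D(3) by (auto simp: bounded_pos)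
  have diff: "\<bar>blinfun_apply v x - blinfun_apply w x\<bar> \<le> norm (v - w) * R" if "x \<in> D" for v w :: "'a \<Rightarrow>\<^sub>L real" and x
    using blinfun_abs_le[of "v - w" x] mult_left_mono[OF R(2)[OF that], of "norm (v - w)"]
    by (simp add: blinfun.diff_left)
  have "open (U n)" for n
    unfolding open_dist
  proof
    fix w assume "w \<in> U n"
    then obtain a where a: "0 < a" and small: "\<forall>x\<in>slice D (\<lambda>x. \<psi> x + blinfun_apply w x) a.
        \<forall>y\<in>slice D (\<lambda>x. \<psi> x + blinfun_apply w x) a. dist x y \<le> inverse (Suc n)"
      by (auto simp: U_def has_small_slice_def)
    \<comment> \<open>With this radius the values on \<open>D\<close>, and hence the supremum, move
      by at most a / 4, so the slice of depth a / 2 for v lies in the slice of depth a for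
      w.\<close>
    have "v \<in> U n" if v: "dist v w < a / (4 * R)" for v
    proof -
      have vR: "norm (v - w) * R \<le> a / 4"
        using v R(1) by (simp add: dist_norm field_simps)
      have "p w \<le> p v + a / 4"
        unfolding p_def[of w]
      proof (rule cSUP_least[OF D(4)])
        show "\<psi> x + blinfun_apply w x \<le> p v + a / 4" if "x \<in> D" for x
          using diff[OF that, of v w] p_ge[OF that, of v] vR by linarith
      qed
      then have sub: "slice D (\<lambda>x. \<psi> x + blinfun_apply v x) (a / 2) \<subseteq> slice D (\<lambda>x. \<psi> x + blinfun_apply w x) a"
        unfolding slice_def p_def[symmetric] using diff[of _ v w] vR by fastforce
      show ?thesis
        unfolding U_def has_small_slice_def
        by (rule CollectI, rule exI[of _ "a / 2"]) (use a small sub in auto)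
    qed
    then show "\<exists>e>0. \<forall>v. dist v w < e \<longrightarrow> v \<in> U n"
      using a R(1) by (intro exI[of _ "a / (4 * R)"]) auto
  qed
  moreover have "\<exists>w\<in>U n. dist w w0 < d" if d: "0 < d" for n w0 d
  proof -
    have "0 < inverse (real (Suc n))" by simp
    then obtain w where "norm (w - w0) < d" "has_small_slice D (\<lambda>x. \<psi> x + blinfun_apply w x) (inverse (Suc n))"
      using small_slice_dense[OF dent D psi d] by blast
    then show ?thesis by (auto simp: U_def dist_norm)
  qed
  ultimately obtain w where w: "w \<in> ball 0 e" "\<And>n. w \<in> U n"
    using Baire_banach[of U "ball 0 e"] e by (metis ball_eq_empty linorder_not_le open_ball)
  let ?F = "\<lambda>x. \<psi> x + blinfun_apply w x"
  \<comment> \<open>Taking both sequences equal gives the Cauchy property; comparing an arbitrary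
    one with a fixed one gives the common limit.\<close>
  have ev: "\<exists>N. \<forall>k\<ge>N. \<forall>l\<ge>N. dist (X k) (Y l) \<le> inverse (Suc n)"
    if X: "\<And>n. X n \<in> D" "(\<lambda>n. ?F (X n)) \<longlonglongrightarrow> p w" and Y: "\<And>n. Y n \<in> D" "(\<lambda>n. ?F (Y n)) \<longlonglongrightarrow> p w" for X Y n
  proof -
    obtain a where a: "0 < a" and small: "\<forall>x\<in>slice D ?F a. \<forall>y\<in>slice D ?F a. dist x y \<le> inverse (Suc n)"
      using w(2)[of n] by (auto simp: U_def has_small_slice_def)
    have "\<forall>\<^sub>F k in sequentially. p w - a < ?F (X k)" "\<forall>\<^sub>F k in sequentially. p w - a < ?F (Y k)"
      using X(2) Y(2) a by (auto intro: order_tendstoD)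
    then have "\<forall>\<^sub>F k in sequentially. X k \<in> slice D ?F a \<and> Y k \<in> slice D ?F a"
      by eventually_elim (use X Y in \<open>auto simp: slice_def p_def\<close>)
    then show ?thesis unfolding eventually_sequentially using small by meson
  qed
  obtain X where X: "\<And>n. X n \<in> D" and Xlim: "(\<lambda>n. ?F (X n)) \<longlonglongrightarrow> p w"
    using maximizing_sequence[OF D(4) bdd[of w]] unfolding p_def by blast
  have "Cauchy X"
  proof (rule metric_CauchyI)
    fix d :: real assume "0 < d"
    then obtain n where "inverse (real (Suc n)) < d" using reals_Archimedean by blast
    then show "\<exists>M. \<forall>k\<ge>M. \<forall>l\<ge>M. dist (X k) (X l) < d"
      using ev[OF X Xlim X Xlim, of n] by (meson le_less_trans)
  qed
  then obtain x where x: "X \<longlonglongrightarrow> x" by (auto simp: Cauchy_convergent_iff convergent_def)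
  have xD: "x \<in> D" using closed_sequentially[OF D(1)] X x by blast
  have "Y \<longlonglongrightarrow> x" if Y: "\<And>n. Y n \<in> D" "(\<lambda>n. ?F (Y n)) \<longlonglongrightarrow> p w" for Y
  proof (rule metric_LIMSEQ_I)
    fix d :: real assume "0 < d"
    then obtain n where n: "inverse (real (Suc n)) < d" using reals_Archimedean by blast
    obtain N where N: "\<forall>k\<ge>N. \<forall>l\<ge>N. dist (Y k) (X l) \<le> inverse (Suc n)"
      using ev[OF Y X Xlim, of n] by blast
    have "dist (Y k) x \<le> inverse (Suc n)" if "k \<ge> N" for k
      by (rule tendsto_upperbound[OF tendsto_dist[OF tendsto_const x]])
        (use N that in \<open>auto simp: eventually_sequentially\<close>)
    then show "\<exists>N. \<forall>k\<ge>N. dist (Y k) x < d" using n by (meson le_less_trans)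
  qed
  then show thesis using that[of w x] w(1) xD by (simp add: p_def)
qed

subsection \<open>Complex duals\<close>

lemma bounded_linear_scaleC_left: "bounded_linear (\<lambda>c. c *\<^sub>C (x :: 'a::complex_normed_vector))"
  by (rule bounded_linear_intro[where K="norm x"])
    (simp_all add: scaleC_add_left scaleR_scaleC scaleC_scaleC norm_scaleC scaleC_complex_def)

lemma complex_dual_scaleC: "xs \<in> complex_dual \<Longrightarrow> blinfun_apply xs (c *\<^sub>C x) = c * blinfun_apply xs x"
  by (simp add: complex_dual_def)

lemma Im_complex_dual: "xs \<in> complex_dual \<Longrightarrow> Im (blinfun_apply xs x) = - Re (blinfun_apply xs (\<i> *\<^sub>C x))"
  by (simp add: complex_dual_scaleC)

lemma complex_dual_eqI:
  assumes "xs \<in> complex_dual" "ys \<in> complex_dual"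
    and "\<And>x. Re (blinfun_apply xs x) = Re (blinfun_apply ys x)"
  shows "xs = ys"
  using assms by (intro blinfun_eqI complex_eqI) (auto simp: Im_complex_dual)

lemma complex_dual_add: "xs \<in> complex_dual \<Longrightarrow> ys \<in> complex_dual \<Longrightarrow> xs + ys \<in> complex_dual"
  and complex_dual_scaleR: "xs \<in> complex_dual \<Longrightarrow> r *\<^sub>R xs \<in> complex_dual"
  by (simp_all add: complex_dual_def blinfun.add_left blinfun.scaleR_left distrib_left)

lemma linear_Re_blinfun: "linear (\<lambda>x. Re (blinfun_apply xs x))"
  by (simp add: linear_iff blinfun.add_right blinfun.scaleR_right)

lemma dual_ball_norm_le: "xs \<in> dual_ball \<Longrightarrow> cmod (blinfun_apply xs x) \<le> norm x"
  using norm_blinfun[of xs x] mult_right_mono[of "norm xs" 1 "norm x"]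
  by (fastforce simp: dual_ball_def)

lemma dual_ball_Re_le: "xs \<in> dual_ball \<Longrightarrow> Re (blinfun_apply xs x) \<le> norm x"
  using dual_ball_norm_le complex_Re_le_cmod order_trans by blast

lemma Re_eq_norm_bound:
  assumes "cmod w \<le> r" "Re w = r"
  shows "w = complex_of_real r"
proof -
  have "(cmod w)\<^sup>2 \<le> r\<^sup>2" using assms(1) by (intro power_mono) auto
  then have "Im w = 0" using assms(2) by (simp add: cmod_power2)
  then show ?thesis using assms(2) by (simp add: complex_eq_iff)
qed

text \<open>By \<open>Im_complex_dual\<close> a complex functional is determined by its real part;
  this is the one with real part \<open>f\<close>.\<close>

definition complexify :: "('a::complex_normed_vector \<Rightarrow> real) \<Rightarrow> 'a \<Rightarrow>\<^sub>L complex"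
  where "complexify f = Blinfun (\<lambda>x. Complex (f x) (- f (\<i> *\<^sub>C x)))"

lemma
  assumes f: "linear f" and le: "\<And>x. f x \<le> K * norm x" and K: "0 \<le> K"
  shows complexify_dual: "complexify f \<in> complex_dual"
    and norm_complexify: "norm (complexify f) \<le> K"
    and Re_complexify: "Re (blinfun_apply (complexify f) x) = f x"
proof -
  let ?F = "\<lambda>x. Complex (f x) (- f (\<i> *\<^sub>C x))"
  have scaleC: "?F (c *\<^sub>C x) = c * ?F x" for c x
  proof -
    have c: "c = complex_of_real (Re c) + complex_of_real (Im c) * \<i>" by (simp add: complex_eq mult.commute)
    have 1: "c *\<^sub>C x = Re c *\<^sub>R x + Im c *\<^sub>R \<i> *\<^sub>C x"
      by (subst c) (simp add: scaleC_add_left scaleR_scaleC scaleC_scaleC)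
    have 2: "\<i> *\<^sub>C c *\<^sub>C x = Re c *\<^sub>R \<i> *\<^sub>C x + Im c *\<^sub>R (- 1) *\<^sub>R x"
      by (subst c) (simp only: scaleR_scaleC scaleC_scaleC flip: scaleC_add_left, simp add: algebra_simps)
    show ?thesis
      using arg_cong[OF 1, of f] arg_cong[OF 2, of f]
      by (simp add: complex_eq_iff linear_add[OF f] linear_diff[OF f] linear_scale[OF f] linear_neg[OF f])
  qed
  have add: "?F (x + y) = ?F x + ?F y" for x y
    by (simp add: complex_eq_iff scaleC_add_right linear_add[OF f])
  have scaleR: "?F (r *\<^sub>R x) = r *\<^sub>R ?F x" for r x
    using scaleC[of "complex_of_real r" x] by (simp add: scaleR_scaleC scaleC_complex_def)
  have norm: "cmod (?F x) \<le> norm x * K" for x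
  proof (cases "?F x = 0")
    case False
    \<comment> \<open>A unimodular factor makes the value real and positive, so the bound on the
      real part \<open>f\<close> bounds the modulus with the same constant.\<close>
    define c where "c = cnj (?F x) / cmod (?F x)"
    have "?F (c *\<^sub>C x) = cmod (?F x)"
      unfolding scaleC c_def using False
      by (simp add: complex_norm_square[symmetric] power2_eq_square mult.commute)
    then have "cmod (?F x) = f (c *\<^sub>C x)" by (metis Re_complex_of_real complex.sel(1))
    also have "\<dots> \<le> K * norm (c *\<^sub>C x)" by (rule le)
    also have "\<dots> = norm x * K" using False by (simp add: norm_scaleC c_def norm_divide mult.commute)
    finally show ?thesis .
  next
    case True
    then show ?thesis using K by simp
  qed
  have bl: "bounded_linear ?F" by (rule bounded_linear_intro[OF add scaleR norm])
  note ap = bounded_linear_Blinfun_apply[OF bl]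
  show "complexify f \<in> complex_dual"
    unfolding complexify_def complex_dual_def using scaleC by (simp add: ap)
  show "Re (blinfun_apply (complexify f) x) = f x" by (simp add: complexify_def ap)
  show "norm (complexify f) \<le> K"
    unfolding complexify_def by (rule norm_blinfun_bound[OF K]) (use norm in \<open>simp add: ap mult.commute\<close>)
qed

lemma complexify_dual_ball:
  assumes "linear f" "\<And>x. f x \<le> norm x"
  shows "complexify f \<in> dual_ball" "Re (blinfun_apply (complexify f) x) = f x"
  using complexify_dual[of f 1] norm_complexify[of f 1] Re_complexify[of f 1] assms
  by (auto simp: dual_ball_def)

text \<open>Brings extremality in the complex dual ball into the real form required by
  \<open>extreme_le_Max\<close>; \<open>complexify\<close> carries real functionals below the norm
  to points of the ball.\<close>

lemma extreme_dual_ball_Re: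
  assumes xs: "xs extreme_point_of (dual_ball :: ('a::complex_normed_vector \<Rightarrow>\<^sub>L complex) set)"
    and gh: "linear g" "linear h" "\<And>x. g x \<le> norm x" "\<And>x. h x \<le> norm x" and u: "0 < u" "u < 1"
    and eq: "\<And>x. Re (blinfun_apply xs x) = (1 - u) * g x + u * h x"
  shows "g = (\<lambda>x. Re (blinfun_apply xs x)) \<and> h = (\<lambda>x. Re (blinfun_apply xs x))"
proof -
  note g = complexify_dual_ball[OF gh(1,3)] and h = complexify_dual_ball[OF gh(2,4)]
  have dual: "xs \<in> complex_dual" "complexify g \<in> complex_dual" "complexify h \<in> complex_dual"
    using xs g(1) h(1) by (auto simp: extreme_point_of_def dual_ball_def)
  have *: "xs = (1 - u) *\<^sub>R complexify g + u *\<^sub>R complexify h"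
    by (rule complex_dual_eqI)
      (use dual eq in \<open>auto intro!: complex_dual_add complex_dual_scaleR
        simp: blinfun.add_left blinfun.scaleR_left g(2) h(2)\<close>)
  have "xs \<notin> open_segment (complexify g) (complexify h)"
    using xs g(1) h(1) by (auto simp: extreme_point_of_def)
  then have "complexify g = complexify h" using * u by (auto simp: in_segment)
  moreover from this have "xs = complexify g"
    using * by (simp flip: scaleR_left_distrib)
  ultimately show ?thesis using g(2) h(2) by auto
qed

text \<open>The functionals below the face functional of the norm at z are the real parts of those
  in the ball that attain the norm at z. This is a face of the ball, so its extreme points are
  extreme in the whole ball.\<close>

lemma extreme_dual_ball_norming:
  fixes z :: "'a::complex_normed_vector"
  obtains xs where "xs extreme_point_of dual_ball" "blinfun_apply xs z = norm z"
proof (rule extreme_dominated_functional_exists[OF sublinear_face_functional[OF sublinear_norm, of z]])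
  fix f assume f: "linear f" "\<And>x. f x \<le> face_functional norm z x"
    and ext: "\<And>g h u. linear g \<Longrightarrow> linear h \<Longrightarrow> (\<And>x. g x \<le> face_functional norm z x) \<Longrightarrow>
       (\<And>x. h x \<le> face_functional norm z x) \<Longrightarrow>
       0 < u \<Longrightarrow> u < 1 \<Longrightarrow> (\<And>x. f x = (1 - u) * g x + u * h x) \<Longrightarrow> g = f \<and> h = f"
  have fn: "f x \<le> norm x" for x
    using f(2)[of x] face_functional_le[OF sublinear_norm, of 0 z x] by simp
  have fz: "f z = norm z"
    using fn[of z] f(2)[of "- z"] face_functional_uminus[OF sublinear_norm, of z] linear_neg[OF f(1), of z]
    by simp
  note F = complexify_dual_ball[OF f(1) fn]
  show thesis
  proof (rule that[of "complexify f"])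
    have "complexify f \<notin> open_segment a b" if ab: "a \<in> dual_ball" "b \<in> dual_ball" for a b
    proof
      assume "complexify f \<in> open_segment a b"
      then obtain u where u: "a \<noteq> b" "0 < u" "u < 1" "complexify f = (1 - u) *\<^sub>R a + u *\<^sub>R b"
        by (auto simp: in_segment)
      let ?g = "\<lambda>x. Re (blinfun_apply a x)" and ?h = "\<lambda>x. Re (blinfun_apply b x)"
      have eq: "f x = (1 - u) * ?g x + u * ?h x" for x
        unfolding F(2)[symmetric] u(4) by (simp add: blinfun.add_left blinfun.scaleR_left)
      have le: "?g x \<le> norm x" "?h x \<le> norm x" for x using ab by (auto intro: dual_ball_Re_le)
      have "(1 - u) * (norm z - ?g z) + u * (norm z - ?h z) = 0"
        using eq[of z] fz by (simp add: algebra_simps)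
      moreover have "0 \<le> (1 - u) * (norm z - ?g z)" "0 \<le> u * (norm z - ?h z)"
        using le[of z] u by (auto intro!: mult_nonneg_nonneg)
      ultimately have "(1 - u) * (norm z - ?g z) = 0" "u * (norm z - ?h z) = 0" by linarith+
      then have z: "?g z = norm z" "?h z = norm z" using u by auto
      have "?g = f \<and> ?h = f"
        by (rule ext[OF _ _ _ _ u(2,3) eq])
          (auto intro!: linear_Re_blinfun face_functional_greatest[OF sublinear_norm] le z)
      then have "?g x = ?h x" for x by metis
      then have "a = b" using ab by (intro complex_dual_eqI) (auto simp: dual_ball_def)
      then show False using u(1) by simp
    qed
    then show "complexify f extreme_point_of dual_ball"
      using F(1) by (auto simp: extreme_point_of_def)
    show "blinfun_apply (complexify f) z = norm z"
      using Re_eq_norm_bound[OF dual_ball_norm_le[OF F(1)]] by (simp add: F(2) fz)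
  qed
qed

definition Re_blinfun :: "('a::real_normed_vector \<Rightarrow>\<^sub>L complex) \<Rightarrow> 'a \<Rightarrow>\<^sub>L real"
  where "Re_blinfun xs = Blinfun (\<lambda>x. Re (blinfun_apply xs x))"

lemma Re_blinfun_apply: "blinfun_apply (Re_blinfun xs) x = Re (blinfun_apply xs x)"
  unfolding Re_blinfun_def
  by (subst bounded_linear_Blinfun_apply)
    (auto intro: bounded_linear_compose[OF bounded_linear_Re blinfun.bounded_linear_right])

text \<open>The closed convex hull of \<open>A\<close> has a strongly exposed point x, as it is
  nonempty and the closed hull of such points. If no slice of \<open>A\<close> by the exposing
  functional were small, points at distance more than e in ever thinner slices would both converge
  to x, although x need not belong to \<open>A\<close>.\<close>

lemma radon_nikodym_all_dentable:
  assumes RNP: "radon_nikodym_property TYPE('a::complex_banach)"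
  shows "all_dentable TYPE('a)"
  unfolding all_dentable_def
proof (intro allI impI)
  fix A :: "'a set" and e :: real assume A: "A \<noteq> {}" "bounded A" and e: "0 < e"
  define K where "K = closure (convex hull A)"
  have AK: "A \<subseteq> K" unfolding K_def using hull_subset closure_subset by (metis order_trans)
  have "bounded K" unfolding K_def using A(2) by (intro bounded_closure bounded_convex_hull)
  moreover have "closed K" "convex K" by (auto simp: K_def convex_closure)
  ultimately have "K = closure (convex hull {x. strongly_exposed_point x K})"
    using RNP A AK unfolding radon_nikodym_property_def by blast
  then obtain x where "strongly_exposed_point x K" using A AK by fastforce
  then obtain xs where xK: "x \<in> K" and bdd: "bdd_above ((\<lambda>y. Re (blinfun_apply xs y)) ` K)"
    and sup: "Re (blinfun_apply xs x) = (SUP y\<in>K. Re (blinfun_apply xs y))"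
    and lim: "\<And>X. (\<And>n. X n \<in> K) \<Longrightarrow> (\<lambda>n. Re (blinfun_apply xs (X n))) \<longlonglongrightarrow> Re (blinfun_apply xs x) \<Longrightarrow>
      (\<lambda>n. norm (X n - x)) \<longlonglongrightarrow> 0"
    unfolding strongly_exposed_point_def by blast
  define f where "f = Re_blinfun xs"
  note f = Re_blinfun_apply[of xs, folded f_def]
  define s where "s = (SUP y\<in>A. f y)"
  have bddA: "bdd_above (f ` A)" by (rule bdd_above_blinfun_image[OF A(2)])
  \<comment> \<open>A closed half-space containing \<open>A\<close> contains its closed convex hull,
    so a slice of \<open>A\<close> is measured from the same level as one of
    \<open>K\<close>.\<close>
  have "K \<subseteq> {y. f y \<le> s}"
    unfolding K_def
  proof (intro closure_minimal hull_minimal)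
    show "A \<subseteq> {y. f y \<le> s}" unfolding s_def using cSUP_upper[OF _ bddA] by auto
    show "convex {y. f y \<le> s}"
      using convex_halfspace_le[of _ s] unfolding convex_alt
      by (auto simp: blinfun.add_right blinfun.scaleR_right convex_bound_le)
    show "closed {y. f y \<le> s}" by (intro closed_Collect_le continuous_intros)
  qed
  then have fx: "f x \<le> s" using xK by auto
  have le_fx: "f y \<le> f x" if "y \<in> A" for y
    using cSUP_upper[OF _ bdd, of y] that AK by (auto simp: f sup)
  show "\<exists>f :: 'a \<Rightarrow>\<^sub>L real. has_small_slice A (blinfun_apply f) e"
  proof (rule exI[of _ f], rule ccontr)
    assume no: "\<not> has_small_slice A f e"
    have ex: "\<exists>y y'. y \<in> slice A (blinfun_apply f) (inverse (real (Suc n))) \<and> y' \<in> slice A (blinfun_apply f) (inverse (real (Suc n))) \<and> e < dist y y'" for n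
    proof -
      have "0 < inverse (real (Suc n))" by simp
      then show ?thesis using no unfolding has_small_slice_def by (meson not_le)
    qed
    then obtain X Y where XY: "\<And>n. X n \<in> slice A (blinfun_apply f) (inverse (real (Suc n)))" "\<And>n. Y n \<in> slice A (blinfun_apply f) (inverse (real (Suc n)))"
      and far: "\<And>n. e < dist (X n) (Y n)" by metis
    have conv: "Z \<longlonglongrightarrow> x" if Z: "\<And>n. Z n \<in> slice A (blinfun_apply f) (inverse (real (Suc n)))" for Z
    proof -
      have ZA: "Z n \<in> A" and Zf: "s - inverse (real (Suc n)) < f (Z n)" for n
        using Z[of n] by (auto simp: slice_def s_def)
      have "(\<lambda>n. f x - inverse (real (Suc n))) \<longlonglongrightarrow> f x - 0"
        by (intro tendsto_intros LIMSEQ_inverse_real_of_nat)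
      then have "(\<lambda>n. f x - inverse (real (Suc n))) \<longlonglongrightarrow> f x" by simp
      then have "(\<lambda>n. f (Z n)) \<longlonglongrightarrow> f x"
      proof (rule tendsto_sandwich[rotated 2, OF _ tendsto_const])
        have "f x - inverse (real (Suc n)) \<le> f (Z n)" for n using Zf[of n] fx by linarith
        then show "\<forall>\<^sub>F n in sequentially. f x - inverse (real (Suc n)) \<le> f (Z n)" by simp
        show "\<forall>\<^sub>F n in sequentially. f (Z n) \<le> f x" using le_fx ZA by simp
      qed
      then have "(\<lambda>n. norm (Z n - x)) \<longlonglongrightarrow> 0" using lim[of Z] ZA AK by (auto simp: f)
      then show ?thesis by (rule LIM_zero_cancel[OF tendsto_norm_zero_cancel])
    qed
    have "(\<lambda>n. dist (X n) (Y n)) \<longlonglongrightarrow> dist x x"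
      by (intro tendsto_dist conv XY)
    then have "e \<le> dist x x"
      by (rule tendsto_lowerbound) (use far in \<open>auto intro!: always_eventually less_imp_le\<close>)
    then show False using e by simp
  qed
qed

subsection \<open>Extreme and exposed functionals\<close>

lemma dual_ball_rotate:
  assumes "xs \<in> dual_ball" "cmod c = 1"
  obtains ys where "ys \<in> dual_ball" "\<And>x. blinfun_apply ys x = c * blinfun_apply xs x"
proof -
  have bl: "bounded_linear (\<lambda>x. c * blinfun_apply xs x)"
    by (rule bounded_linear_compose[OF bounded_linear_mult_right blinfun.bounded_linear_right])
  note ap = bounded_linear_Blinfun_apply[OF bl]
  have "norm (Blinfun (\<lambda>x. c * blinfun_apply xs x)) \<le> 1"
    by (rule norm_blinfun_bound) (use dual_ball_norm_le[OF assms(1)] assms(2) in \<open>auto simp: ap norm_mult\<close>)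
  then have "Blinfun (\<lambda>x. c * blinfun_apply xs x) \<in> dual_ball"
    using assms(1) by (auto simp: dual_ball_def complex_dual_def ap)
  then show thesis using that ap by metis
qed

lemma
  assumes K: "K \<noteq> {}" "K \<subseteq> (dual_ball :: ('a::complex_normed_vector \<Rightarrow>\<^sub>L complex) set)"
  shows sublinear_support: "sublinear (\<lambda>y. SUP z\<in>K. Re (blinfun_apply z y))"
    and support_le_norm: "(SUP z\<in>K. Re (blinfun_apply z y)) \<le> norm y"
    and support_upper: "z \<in> K \<Longrightarrow> Re (blinfun_apply z y) \<le> (SUP z\<in>K. Re (blinfun_apply z y))"
proof -
  let ?p = "\<lambda>y. SUP z\<in>K. Re (blinfun_apply z y)"
  have le: "Re (blinfun_apply z y) \<le> norm y" if "z \<in> K" for z y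
    using K(2) that dual_ball_Re_le by blast
  have bdd: "bdd_above ((\<lambda>z. Re (blinfun_apply z y)) ` K)" for y
    by (rule bdd_aboveI[of _ "norm y"]) (use le in auto)
  have upper: "Re (blinfun_apply z y) \<le> ?p y" if "z \<in> K" for z y
    by (rule cSUP_upper[OF that bdd])
  then show "z \<in> K \<Longrightarrow> Re (blinfun_apply z y) \<le> ?p y" .
  show "?p y \<le> norm y" by (rule cSUP_least[OF K(1) le])
  show "sublinear ?p"
  proof (rule sublinearI)
    show "?p (x + y) \<le> ?p x + ?p y" for x y
    proof (rule cSUP_least[OF K(1)])
      show "Re (blinfun_apply z (x + y)) \<le> ?p x + ?p y" if "z \<in> K" for z
        using upper[OF that, of x] upper[OF that, of y] by (simp add: blinfun.add_right)
    qed
    show "?p (c *\<^sub>R x) \<le> c * ?p x" if "0 < c" for c x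
    proof (rule cSUP_least[OF K(1)])
      show "Re (blinfun_apply z (c *\<^sub>R x)) \<le> c * ?p x" if "z \<in> K" for z
        using upper[OF that, of x] \<open>0 < c\<close> by (simp add: blinfun.scaleR_right)
    qed
    show "?p 0 = 0" using K(1) by simp
  qed
qed

text \<open>
  The functionals that are almost unimodular at \<open>x0\<close> are norming, and finitely many convex pieces
  \<open>K c\<close>, on each of which evaluation at \<open>x0\<close> is almost constant, exhaust them. So an extreme
  functional belongs to the closure of one of these pieces.
\<close>
lemma extreme_unimodular_if_norming:
  fixes x0 :: "'a::complex_normed_vector"
  assumes norming: "\<And>y d. norm y = 1 \<Longrightarrow> 0 < d \<Longrightarrow>
      \<exists>xs\<in>dual_ball. 1 - d < cmod (blinfun_apply xs x0) \<and> 1 - d < Re (blinfun_apply xs y)"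
    and x0: "norm x0 \<le> 1" and nontrivial: "\<exists>x :: 'a. x \<noteq> 0"
    and f: "f extreme_point_of (dual_ball :: ('a \<Rightarrow>\<^sub>L complex) set)"
  shows "cmod (blinfun_apply f x0) = 1"
proof -
  have fball: "f \<in> dual_ball" using f by (simp add: extreme_point_of_def)
  have "1 \<le> cmod (blinfun_apply f x0) + e" if e: "0 < e" for e
  proof -
    \<comment> \<open>One d is lost from the inner radius of the annulus \<open>R\<close> and one
      from approximating the value at x0 by a point c of the net.\<close>
    define d where "d = e / 2"
    have d: "0 < d" using e by (simp add: d_def)
    define R where "R = {c. 1 - d \<le> cmod c \<and> cmod c \<le> 1}"
    have "compact R"
      unfolding R_def compact_eq_bounded_closed
      by (auto simp: bounded_iff intro!: exI[of _ 1] closed_Collect_conj closed_Collect_le continuous_intros)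
    then obtain N where N: "finite N" "N \<subseteq> R" "R \<subseteq> (\<Union>c\<in>N. ball c d)"
      using d seq_compact_imp_totally_bounded[of R] compact_imp_seq_compact by meson
    define K where "K c = {z \<in> dual_ball. cmod (blinfun_apply z x0 - c) \<le> d}" for c
    define p where "p c y = (SUP z\<in>K c. Re (blinfun_apply z y))" for c y
    define M where "M = {c \<in> N. K c \<noteq> {}}"
    have Kball: "K c \<subseteq> dual_ball" for c by (auto simp: K_def)
    have M: "finite M" using N(1) by (simp add: M_def)
    have psub: "sublinear (p c)" and pn: "p c y \<le> norm y" if "c \<in> M" for c y
      using sublinear_support[OF _ Kball] support_le_norm[OF _ Kball] that
      by (auto simp: M_def p_def[abs_def])
    have cover: "\<exists>c\<in>M. 1 - r < p c y" if y: "norm y = 1" and r: "0 < r" for y r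
    proof -
      \<comment> \<open>The minimum makes one functional do both jobs: its value at x0 falls into
        the annulus, and it norms y up to r.\<close>
      obtain z where z: "z \<in> dual_ball" "1 - min r d < cmod (blinfun_apply z x0)"
        "1 - min r d < Re (blinfun_apply z y)"
        using norming[OF y, of "min r d"] r d by auto
      have "blinfun_apply z x0 \<in> R"
        using z(2) dual_ball_norm_le[OF z(1), of x0] x0 by (auto simp: R_def)
      then obtain c where c: "c \<in> N" "dist c (blinfun_apply z x0) < d" using N(3) by auto
      then have zK: "z \<in> K c" using z(1) by (auto simp: K_def dist_norm norm_minus_commute)
      then have "c \<in> M" using c by (auto simp: M_def)
      moreover have "Re (blinfun_apply z y) \<le> p c y"
        unfolding p_def by (rule support_upper[OF _ Kball zK]) (use zK in auto)
      ultimately show ?thesis using z(3) by (intro bexI[of _ c]) auto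
    qed
    obtain v :: 'a where "norm v = 1"
      using nontrivial by (metis norm_sgn)
    then have Mne: "M \<noteq> {}" using cover[of v 1] by auto
    have norm_le: "norm y \<le> Max ((\<lambda>c. p c y) ` M)" for y
    proof (cases "y = 0")
      case True
      then show ?thesis using Mne M psub by (auto simp: sublinear_zero)
    next
      case False
      show ?thesis
      proof (rule field_le_epsilon)
        fix r :: real assume r: "0 < r"
        have ny: "norm ((1 / norm y) *\<^sub>R y) = 1" using False by simp
        obtain c where c: "c \<in> M" "1 - r / norm y < p c ((1 / norm y) *\<^sub>R y)"
          using cover[OF ny, of "r / norm y"] r False by auto
        have "p c ((1 / norm y) *\<^sub>R y) = (1 / norm y) * p c y"
          by (rule sublinear_scale[OF psub[OF c(1)]]) simp
        then have "norm y - r < p c y" using c(2) False by (simp add: field_simps)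
        moreover have "p c y \<le> Max ((\<lambda>c. p c y) ` M)" using M c(1) by auto
        ultimately show "norm y \<le> Max ((\<lambda>c. p c y) ` M) + r" by simp
      qed
    qed
    have "\<exists>c\<in>M. \<forall>y. Re (blinfun_apply f y) \<le> p c y"
    proof (rule extreme_le_Max[OF linear_Re_blinfun _ M Mne psub pn])
      show "g = (\<lambda>x. Re (blinfun_apply f x)) \<and> h = (\<lambda>x. Re (blinfun_apply f x))"
        if "linear g" "linear h" "\<And>x. g x \<le> norm x" "\<And>x. h x \<le> norm x" "0 < u" "u < 1"
          "\<And>x. Re (blinfun_apply f x) = (1 - u) * g x + u * h x" for g h u
        by (rule extreme_dual_ball_Re[OF f that])
      show "Re (blinfun_apply f y) \<le> Max ((\<lambda>c. p c y) ` M)" for y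
        using dual_ball_Re_le[OF fball, of y] norm_le[of y] by linarith
    qed
    then obtain c where c: "c \<in> M" and fc: "\<And>y. Re (blinfun_apply f y) \<le> p c y" by blast
    \<comment> \<open>Testing at \<open>cnj w *\<^sub>C x0\<close> measures the deviation from c in
      its own direction: \<open>f\<close> exceeds Re (cnj w c) by the square of |w|, but members of
      \<open>K c\<close> exceed it by at most |w| d.\<close>
    define w where "w = blinfun_apply f x0 - c"
    have "p c (cnj w *\<^sub>C x0) \<le> Re (cnj w * c) + cmod w * d"
      unfolding p_def
    proof (rule cSUP_least)
      show "K c \<noteq> {}" using c by (simp add: M_def)
      fix z assume z: "z \<in> K c"
      then have "z \<in> complex_dual" by (simp add: K_def dual_ball_def)
      then have "Re (blinfun_apply z (cnj w *\<^sub>C x0)) = Re (cnj w * c) + Re (cnj w * (blinfun_apply z x0 - c))"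
        by (simp add: complex_dual_scaleC algebra_simps)
      also have "Re (cnj w * (blinfun_apply z x0 - c)) \<le> cmod (cnj w * (blinfun_apply z x0 - c))"
        by (rule complex_Re_le_cmod)
      also have "\<dots> \<le> cmod w * d" using z by (auto simp: norm_mult K_def intro: mult_left_mono)
      finally show "Re (blinfun_apply z (cnj w *\<^sub>C x0)) \<le> Re (cnj w * c) + cmod w * d" by simp
    qed
    then have "Re (cnj w * blinfun_apply f x0) \<le> Re (cnj w * c) + cmod w * d"
      using fc[of "cnj w *\<^sub>C x0"] fball by (simp add: complex_dual_scaleC dual_ball_def)
    then have "Re (cnj w * w) \<le> cmod w * d" by (simp add: w_def algebra_simps)
    then have "cmod w * cmod w \<le> cmod w * d"
      by (simp add: cmod_def power2_eq_square)
    then have "cmod w \<le> d" using d by (cases "w = 0") auto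
    moreover have "1 - d \<le> cmod c" using c N(2) by (auto simp: M_def R_def)
    moreover have "cmod c \<le> cmod (blinfun_apply f x0) + cmod w"
      using norm_triangle_ineq4[of "blinfun_apply f x0" w] by (simp add: w_def)
    ultimately show ?thesis by (simp add: d_def)
  qed
  then have "1 \<le> cmod (blinfun_apply f x0)" by (rule field_le_epsilon)
  then show ?thesis using dual_ball_norm_le[OF fball, of x0] x0 by linarith
qed

text \<open>Both ends of a segment through \<open>xs\<close> are bounded by 1 in modulus at the
  exposing x, where their combination equals 1; so both equal 1 there, and uniqueness identifies
  them with \<open>xs\<close>.\<close>

lemma weak_star_exposed_extreme:
  assumes "xs \<in> weak_star_exposed"
  shows "xs extreme_point_of dual_ball"
proof -
  obtain x where xs: "xs \<in> dual_ball" "norm x \<le> 1" and xsx: "blinfun_apply xs x = 1"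
    and uniq: "\<And>ys. ys \<in> dual_ball \<Longrightarrow> blinfun_apply ys x = 1 \<Longrightarrow> ys = xs"
    using assms unfolding weak_star_exposed_def mem_Collect_eq Bex_def Ball_def mem_cball_0 by blast
  have "xs \<notin> open_segment a b" if ab: "a \<in> dual_ball" "b \<in> dual_ball" for a b
  proof
    assume "xs \<in> open_segment a b"
    then obtain u where u: "a \<noteq> b" "0 < u" "u < 1" "xs = (1 - u) *\<^sub>R a + u *\<^sub>R b"
      by (auto simp: in_segment)
    have le: "cmod (blinfun_apply a x) \<le> 1" "cmod (blinfun_apply b x) \<le> 1"
      using dual_ball_norm_le[OF ab(1), of x] dual_ball_norm_le[OF ab(2), of x] xs(2) by linarith+
    have "1 = (1 - u) * Re (blinfun_apply a x) + u * Re (blinfun_apply b x)"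
      using arg_cong[OF xsx[unfolded u(4)], of Re] by (simp add: blinfun.add_left blinfun.scaleR_left)
    then have "(1 - u) * (1 - Re (blinfun_apply a x)) + u * (1 - Re (blinfun_apply b x)) = 0"
      by (simp add: algebra_simps)
    moreover have "0 \<le> (1 - u) * (1 - Re (blinfun_apply a x))" "0 \<le> u * (1 - Re (blinfun_apply b x))"
      using u le complex_Re_le_cmod[of "blinfun_apply a x"] complex_Re_le_cmod[of "blinfun_apply b x"]
      by (auto intro!: mult_nonneg_nonneg)
    ultimately have "(1 - u) * (1 - Re (blinfun_apply a x)) = 0" "u * (1 - Re (blinfun_apply b x)) = 0"
      by linarith+
    then have "Re (blinfun_apply a x) = 1" "Re (blinfun_apply b x) = 1" using u by auto
    then have "a = xs" "b = xs"
      using Re_eq_norm_bound[OF le(1)] Re_eq_norm_bound[OF le(2)] uniq ab by auto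
    then show False using u(1) by simp
  qed
  then show ?thesis using xs(1) by (auto simp: extreme_point_of_def)
qed

text \<open>
  The second differences of the norm along an arithmetic progression on a line telescope to at
  most \<open>2 * t * norm d\<close>, so one of them is small.
\<close>
lemma small_second_difference:
  fixes d y0 :: "'a::real_normed_vector"
  assumes r: "0 < r" and e: "0 < e"
  obtains y t where "dist y y0 < r" "0 < t" "norm (y + t *\<^sub>R d) + norm (y - t *\<^sub>R d) - 2 * norm y < t * e"
proof -
  obtain N :: nat where N: "2 * norm d < N * e" using reals_Archimedean3[OF e] by blast
  then have "0 < N * e" using norm_ge_zero[of d] by linarith
  then have N0: "0 < real N" using e by (simp add: zero_less_mult_iff)
  \<comment> \<open>N steps of this length along d stay within distance r of y0, while N was chosen
    so large that N e exceeds 2 times the norm of d. The 1 in the denominator covers d = 0.\<close>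
  define t where "t = r / (real N * (norm d + 1))"
  have d1: "0 < norm d + 1" by (rule add_nonneg_pos) auto
  have t: "0 < t" using r N0 d1 by (simp add: t_def)
  define F where "F i = norm (y0 + (real i * t) *\<^sub>R d)" for i
  show thesis
  proof (rule ccontr)
    note pick = that
    assume no: "\<not> thesis"
    have step: "t * e \<le> F (Suc (Suc i)) + F i - 2 * F (Suc i)" if "i < N" for i
    proof -
      define y where "y = y0 + (real (Suc i) * t) *\<^sub>R d"
      have "dist y y0 = real (Suc i) * t * norm d" using t by (simp add: y_def dist_norm)
      also have "\<dots> \<le> real N * t * norm d" using that t by (intro mult_right_mono) auto
      also have "\<dots> < real N * t * (norm d + 1)" using N0 t by simp
      also have "\<dots> = r" using N0 d1 by (simp add: t_def)
      finally have "t * e \<le> norm (y + t *\<^sub>R d) + norm (y - t *\<^sub>R d) - 2 * norm y"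
        using pick[of y t] no t by (meson not_le)
      moreover have "real (Suc (Suc i)) * t = real (Suc i) * t + t" "real i * t = real (Suc i) * t - t"
        by (simp_all add: algebra_simps)
      then have "y + t *\<^sub>R d = y0 + (real (Suc (Suc i)) * t) *\<^sub>R d" "y - t *\<^sub>R d = y0 + (real i * t) *\<^sub>R d"
        by (simp_all only: y_def scaleR_left_distrib scaleR_left_diff_distrib) simp_all
      ultimately show ?thesis by (simp only: F_def y_def)
    qed
    have "F 1 - F 0 + m * (t * e) \<le> F (Suc m) - F m" if "m \<le> N" for m
      using that
    proof (induction m)
      case (Suc m)
      then show ?case using step[of m] by (simp add: algebra_simps)
    qed simp
    from this[OF order_refl] have "N * (t * e) \<le> F (Suc N) - F N - (F 1 - F 0)" by simp
    also have "F (Suc N) \<le> F N + t * norm d"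
      using norm_triangle_ineq[of "y0 + (real N * t) *\<^sub>R d" "t *\<^sub>R d"] t by (simp add: F_def algebra_simps)
    also have "F 0 \<le> F 1 + t * norm d"
      using norm_triangle_ineq4[of "y0 + t *\<^sub>R d" "t *\<^sub>R d"] t by (simp add: F_def)
    finally have "t * (N * e) \<le> t * (2 * norm d)" by (simp add: algebra_simps)
    then show False using N t by simp
  qed
qed

text \<open>By Baire there is y near z at which the second difference quotients of the norm become
  arbitrarily small along each of countably many dense directions. Functionals in the ball norming y
  then agree on those directions, hence everywhere, so y divided by its norm exposes one of
  them.\<close>

theorem mazur_weak_star_exposed:
  fixes z :: "'a::complex_banach"
  assumes sep: "separable_space (euclidean :: 'a topology)" and z: "z \<noteq> 0" and e: "0 < e"
  obtains xs where "xs \<in> weak_star_exposed" "norm z - e \<le> cmod (blinfun_apply xs z)"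
proof -
  obtain C :: "'a set" where C: "countable C" "closure C = UNIV"
    using sep by (auto simp: separable_space_def)
  then have "C \<noteq> {}" by auto
  define d where "d = from_nat_into C"
  have d: "range d = C" unfolding d_def by (rule range_from_nat_into[OF \<open>C \<noteq> {}\<close> C(1)])
  \<comment> \<open>Asking for some t instead of a limit makes this set open, and one such t already
    bounds the difference of two norming functionals.\<close>
  define G where "G u k = (\<Union>t\<in>{0<..}. {y. norm (y + t *\<^sub>R u) + norm (y - t *\<^sub>R u) - 2 * norm y < t * inverse (Suc k)})"
    for u :: 'a and k :: nat
  define U where "U m = (case prod_decode m of (n, k) \<Rightarrow> G (d n) k)" for m
  have "open (G u k)" for u k
    unfolding G_def by (intro open_UN ballI open_Collect_less continuous_intros)
  moreover have "\<exists>y\<in>G u k. dist y x < r" if r: "0 < r" for u k x r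
  proof -
    have "0 < inverse (real (Suc k))" by simp
    from small_second_difference[OF r this, of x u] show ?thesis unfolding G_def by fastforce
  qed
  ultimately have U: "open (U m)" "0 < r \<Longrightarrow> \<exists>y\<in>U m. dist y x < r" for m x r
    by (auto simp: U_def split: prod.splits)
  have "z \<in> ball z (e / 2) - {0}" using z e by simp
  then have "open (ball z (e / 2) - {0})" "ball z (e / 2) - {0} \<noteq> {}"
    by (blast intro: open_delete open_ball)+
  then obtain y where y: "y \<in> ball z (e / 2) - {0}" "\<And>m. y \<in> U m"
    using Baire_banach[of U "ball z (e / 2) - {0}"] U by blast
  have y0: "y \<noteq> 0" using y(1) by simp
  have smooth: "y \<in> G (d n) k" for n k
    using y(2)[of "prod_encode (n, k)"] by (simp add: U_def)
  have le: "Re (blinfun_apply a (d n)) \<le> Re (blinfun_apply b (d n))"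
    if a: "a \<in> dual_ball" "blinfun_apply a y = norm y" and b: "b \<in> dual_ball" "blinfun_apply b y = norm y" for a b n
  proof (rule field_le_epsilon)
    fix r :: real assume "0 < r"
    then obtain k where k: "inverse (real (Suc k)) < r" using reals_Archimedean by blast
    obtain t where t: "0 < t" "norm (y + t *\<^sub>R d n) + norm (y - t *\<^sub>R d n) - 2 * norm y < t * inverse (Suc k)"
      using smooth[of n k] by (auto simp: G_def)
    \<comment> \<open>Adding the bound of a at y + t d and of b at y - t d, and using that both norm
      y, leaves t times their difference at d below the second difference.\<close>
    have "t * (Re (blinfun_apply a (d n)) - Re (blinfun_apply b (d n))) < t * inverse (Suc k)"
      using t(2) dual_ball_Re_le[OF a(1), of "y + t *\<^sub>R d n"] dual_ball_Re_le[OF b(1), of "y - t *\<^sub>R d n"]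
      by (simp add: blinfun.add_right blinfun.diff_right blinfun.scaleR_right a b algebra_simps)
    then have "Re (blinfun_apply a (d n)) - Re (blinfun_apply b (d n)) < inverse (Suc k)"
      using t(1) by (simp only: mult_less_cancel_left_pos)
    then show "Re (blinfun_apply a (d n)) \<le> Re (blinfun_apply b (d n)) + r" using k by linarith
  qed
  have uniq: "a = b"
    if ab: "a \<in> dual_ball" "blinfun_apply a y = norm y" "b \<in> dual_ball" "blinfun_apply b y = norm y" for a b
  proof (rule complex_dual_eqI)
    show "a \<in> complex_dual" "b \<in> complex_dual" using ab by (auto simp: dual_ball_def)
    let ?S = "{x. Re (blinfun_apply a x) = Re (blinfun_apply b x)}"
    have "closed ?S" by (intro closed_Collect_eq continuous_intros)
    moreover have "C \<subseteq> ?S" using le[OF ab] le[OF ab(3,4,1,2)] d by (auto intro: antisym)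
    ultimately have "UNIV \<subseteq> ?S" using C(2) closure_minimal by metis
    then show "Re (blinfun_apply a x) = Re (blinfun_apply b x)" for x by blast
  qed
  obtain xs where "xs extreme_point_of dual_ball" and xy: "blinfun_apply xs y = norm y"
    by (rule extreme_dual_ball_norming)
  then have xs: "xs \<in> dual_ball" by (simp add: extreme_point_of_def)
  show thesis
  proof (rule that)
    have "ys = xs" if "ys \<in> dual_ball" "blinfun_apply ys ((1 / norm y) *\<^sub>R y) = 1" for ys
      using that(2) y0 by (intro uniq[OF that(1) _ xs xy])
        (simp add: blinfun.scaleR_right scaleR_conv_of_real field_simps)
    then show "xs \<in> weak_star_exposed"
      unfolding weak_star_exposed_def mem_Collect_eq
    proof (intro conjI xs bexI[of _ "(1 / norm y) *\<^sub>R y"] ballI impI)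
      show "blinfun_apply xs ((1 / norm y) *\<^sub>R y) = 1"
        using xy y0 by (simp add: blinfun.scaleR_right scaleR_conv_of_real)
    qed (use y0 in auto)
    have "norm y \<le> cmod (blinfun_apply xs z) + norm (y - z)"
      using norm_triangle_ineq[of "blinfun_apply xs z" "blinfun_apply xs (y - z)"]
        dual_ball_norm_le[OF xs, of "y - z"] by (simp add: blinfun.diff_right xy)
    moreover have "norm z \<le> norm y + norm (y - z)" using norm_triangle_sub[of z y] by (simp add: norm_minus_commute)
    moreover have "norm (y - z) < e / 2" using y(1) by (simp add: dist_norm norm_minus_commute)
    ultimately show "norm z - e \<le> cmod (blinfun_apply xs z)" by argo
  qed
qed

subsection \<open>Strong peak points and the numerical index\<close>

lemma C_b_bdd: "f \<in> C_b \<Longrightarrow> bdd_above ((\<lambda>x. norm (f x)) ` cball 0 1)"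
  unfolding C_b_def bounded_iff by (auto simp: bdd_above_def)

lemma norm_le_ball_norm: "f \<in> C_b \<Longrightarrow> norm x \<le> 1 \<Longrightarrow> norm (f x) \<le> ball_norm f"
  unfolding ball_norm_def by (rule cSUP_upper[OF _ C_b_bdd]) auto

lemma ball_norm_least: "(\<And>x. norm x \<le> 1 \<Longrightarrow> norm (f x) \<le> c) \<Longrightarrow> ball_norm f \<le> c"
  unfolding ball_norm_def by (rule cSUP_least) auto

section \<open>Closure properties of \<open>A_u\<close>\<close>

lemma A_u_C_b: "f \<in> A_u \<Longrightarrow> f \<in> C_b"
  by (simp add: A_u_def)

lemma A_uI:
  assumes "frechet_holomorphic_on f (ball 0 1)" "uniformly_continuous_on (cball 0 1) f"
    and "bounded (f ` cball 0 1)"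
  shows "f \<in> A_u"
  using assms by (auto simp: A_u_def C_b_def uniformly_continuous_imp_continuous)

lemma A_u_bounded_linear:
  fixes T :: "'a::complex_banach \<Rightarrow> 'b::complex_banach"
  assumes T: "bounded_linear T" "\<And>c v. T (c *\<^sub>C v) = c *\<^sub>C T v"
  shows "T \<in> A_u"
proof (rule A_uI)
  show "frechet_holomorphic_on T (ball 0 1)"
    unfolding frechet_holomorphic_on_def using bounded_linear_imp_has_derivative[OF T(1)] T(2) by blast
  show "uniformly_continuous_on (cball 0 1) T"
    by (rule bounded_linear.uniformly_continuous_on[OF T(1) uniformly_continuous_on_id])
  show "bounded (T ` cball 0 1)" by (rule bounded_linear_image[OF bounded_cball T(1)])
qed

lemma A_u_compose_bounded_linear:
  fixes f :: "'a::complex_banach \<Rightarrow> 'b::complex_banach" and T :: "'b \<Rightarrow> 'c::complex_banach"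
  assumes f: "f \<in> A_u" and T: "bounded_linear T" "\<And>c v. T (c *\<^sub>C v) = c *\<^sub>C T v"
  shows "(\<lambda>x. T (f x)) \<in> A_u"
proof (rule A_uI)
  show "frechet_holomorphic_on (\<lambda>x. T (f x)) (ball 0 1)"
    unfolding frechet_holomorphic_on_def
  proof
    fix x :: 'a assume "x \<in> ball 0 1"
    then obtain D where "(f has_derivative D) (at x)" "\<forall>c v. D (c *\<^sub>C v) = c *\<^sub>C D v"
      using f unfolding A_u_def frechet_holomorphic_on_def by blast
    then show "\<exists>D. ((\<lambda>x. T (f x)) has_derivative D) (at x) \<and> (\<forall>c v. D (c *\<^sub>C v) = c *\<^sub>C D v)"
      by (intro exI[of _ "\<lambda>v. T (D v)"]) (auto intro: bounded_linear.has_derivative[OF T(1)] simp: T(2))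
  qed
  show "uniformly_continuous_on (cball 0 1) (\<lambda>x. T (f x))"
    using f by (intro bounded_linear.uniformly_continuous_on[OF T(1)]) (simp add: A_u_def)
  have "bounded (T ` f ` cball 0 1)"
    using f by (intro bounded_linear_image[OF _ T(1)]) (simp add: A_u_def C_b_def)
  then show "bounded ((\<lambda>x. T (f x)) ` cball 0 1)" by (simp add: image_image)
qed

lemma A_u_add:
  fixes f g :: "'a::complex_banach \<Rightarrow> 'b::complex_banach"
  assumes f: "f \<in> A_u" and g: "g \<in> A_u"
  shows "(\<lambda>x. f x + g x) \<in> A_u"
proof (rule A_uI)
  show "frechet_holomorphic_on (\<lambda>x. f x + g x) (ball 0 1)"
    unfolding frechet_holomorphic_on_def
  proof
    fix x :: 'a assume x: "x \<in> ball 0 1"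
    obtain D where "(f has_derivative D) (at x)" "\<forall>c v. D (c *\<^sub>C v) = c *\<^sub>C D v"
      using f x unfolding A_u_def frechet_holomorphic_on_def by blast
    moreover obtain E where "(g has_derivative E) (at x)" "\<forall>c v. E (c *\<^sub>C v) = c *\<^sub>C E v"
      using g x unfolding A_u_def frechet_holomorphic_on_def by blast
    ultimately show "\<exists>D. ((\<lambda>x. f x + g x) has_derivative D) (at x) \<and> (\<forall>c v. D (c *\<^sub>C v) = c *\<^sub>C D v)"
      by (intro exI[of _ "\<lambda>v. D v + E v"]) (auto intro: has_derivative_add simp: scaleC_add_right)
  qed
  show "uniformly_continuous_on (cball 0 1) (\<lambda>x. f x + g x)"
    using f g by (intro uniformly_continuous_on_add) (auto simp: A_u_def)
  show "bounded ((\<lambda>x. f x + g x) ` cball 0 1)"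
    using f g by (intro bounded_plus_comp) (auto simp: A_u_def C_b_def)
qed

text \<open>The exponential is not uniformly continuous on the plane, but the range of
  \<open>f\<close> lies in a compact disc, where it is.\<close>

lemma A_u_exp:
  fixes f :: "'a::complex_banach \<Rightarrow> complex"
  assumes f: "f \<in> A_u"
  shows "(\<lambda>x. exp (f x)) \<in> A_u"
proof (rule A_uI)
  show "frechet_holomorphic_on (\<lambda>x. exp (f x)) (ball 0 1)"
    unfolding frechet_holomorphic_on_def
  proof
    fix x :: 'a assume "x \<in> ball 0 1"
    then obtain D where D: "(f has_derivative D) (at x)" "\<forall>c v. D (c *\<^sub>C v) = c *\<^sub>C D v"
      using f unfolding A_u_def frechet_holomorphic_on_def by blast
    have "((\<lambda>x. exp (f x)) has_derivative (\<lambda>v. D v * exp (f x))) (at x)"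
      using has_derivative_compose[OF D(1) DERIV_exp[unfolded has_field_derivative_def]]
      by (simp add: mult.commute)
    then show "\<exists>D. ((\<lambda>x. exp (f x)) has_derivative D) (at x) \<and> (\<forall>c v. D (c *\<^sub>C v) = c *\<^sub>C D v)"
      by (intro exI[of _ "\<lambda>v. D v * exp (f x)"]) (auto simp: D(2) scaleC_complex_def)
  qed
  have "bounded (f ` cball 0 1)" using f by (simp add: A_u_def C_b_def)
  then obtain R where R: "f ` cball 0 1 \<subseteq> cball 0 R"
    unfolding bounded_iff by (auto simp: subset_iff)
  have uc: "uniformly_continuous_on (cball 0 R) (exp :: complex \<Rightarrow> complex)"
    by (intro compact_uniformly_continuous continuous_intros compact_cball)
  then have "uniformly_continuous_on (f ` cball 0 1) (exp :: complex \<Rightarrow> complex)"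
    using R unfolding uniformly_continuous_on_def by (meson subsetD)
  then show "uniformly_continuous_on (cball 0 1) (\<lambda>x. exp (f x))"
    using f uniformly_continuous_on_compose[of "cball 0 1" f exp] by (simp add: A_u_def o_def)
  have "compact (exp ` cball (0 :: complex) R)"
    by (intro compact_continuous_image continuous_intros compact_cball)
  then show "bounded ((\<lambda>x. exp (f x)) ` cball 0 1)"
    by (rule bounded_subset[OF compact_imp_bounded]) (use R in auto)
qed

section \<open>States, numerical radius and numerical index\<close>

lemma Pi_states_nonempty:
  assumes "\<exists>x :: 'a::complex_banach. x \<noteq> 0"
  shows "(Pi_states :: ('a \<times> ('a \<Rightarrow>\<^sub>L complex)) set) \<noteq> {}"
proof -
  obtain x :: 'a where x: "norm x = 1" using assms by (metis norm_sgn)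
  obtain xs :: "'a \<Rightarrow>\<^sub>L complex" where "xs extreme_point_of dual_ball" and xsx: "blinfun_apply xs x = norm x"
    by (rule extreme_dual_ball_norming)
  then have xs: "xs \<in> dual_ball" by (simp add: extreme_point_of_def)
  have "1 \<le> norm xs" using norm_blinfun[of xs x] x xsx by simp
  then have "(x, xs) \<in> Pi_states" using x xs xsx by (auto simp: Pi_states_def dual_ball_def)
  then show ?thesis by blast
qed

lemma Pi_states_le_ball_norm:
  assumes "f \<in> C_b" "(x, xs) \<in> Pi_states"
  shows "cmod (blinfun_apply xs (f x)) \<le> ball_norm f"
  using assms dual_ball_norm_le[of xs "f x"] norm_le_ball_norm[of f x] by (auto simp: Pi_states_def)

lemma bdd_numerical_radius:
  assumes "f \<in> C_b"
  shows "bdd_above ((\<lambda>(x, xs). cmod (blinfun_apply xs (f x))) ` Pi_states)"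
  by (rule bdd_aboveI[of _ "ball_norm f"]) (use Pi_states_le_ball_norm[OF assms] in auto)

lemma numerical_radius_ge:
  assumes "f \<in> C_b" "(x, xs) \<in> Pi_states"
  shows "cmod (blinfun_apply xs (f x)) \<le> numerical_radius f"
  unfolding numerical_radius_def
  using cSUP_upper[OF assms(2) bdd_numerical_radius[OF assms(1)]] by simp

lemma numerical_radius_le:
  assumes "\<exists>x :: 'a::complex_banach. x \<noteq> 0" "f \<in> C_b"
  shows "numerical_radius (f :: 'a \<Rightarrow> 'a) \<le> ball_norm f"
  unfolding numerical_radius_def
  by (rule cSUP_least[OF Pi_states_nonempty[OF assms(1)]]) (use Pi_states_le_ball_norm[OF assms(2)] in auto)

lemma numerical_radius_approx:
  assumes nt: "\<exists>x :: 'a::complex_banach. x \<noteq> 0" and "f \<in> C_b" "c < numerical_radius (f :: 'a \<Rightarrow> 'a)"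
  obtains x xs where "(x, xs) \<in> Pi_states" "c < cmod (blinfun_apply xs (f x))"
  using less_cSUP_iff[OF Pi_states_nonempty[OF nt] bdd_numerical_radius[OF assms(2)]] assms(3) that
  unfolding numerical_radius_def by fastforce

text \<open>The identity map is a competitor of numerical radius at most 1, so the infimum never
  exceeds 1 and equals 1 just when 1 is a lower bound.\<close>

lemma n_u_eq_1_iff:
  assumes nt: "\<exists>x :: 'a::complex_banach. x \<noteq> 0"
  shows "n_u TYPE('a) = 1 \<longleftrightarrow> (\<forall>f :: 'a \<Rightarrow> 'a. f \<in> A_u \<longrightarrow> ball_norm f = 1 \<longrightarrow> 1 \<le> numerical_radius f)"
proof -
  let ?S = "{f :: 'a \<Rightarrow> 'a. f \<in> A_u \<and> ball_norm f = 1}"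
  obtain v :: 'a where v: "norm v = 1" using nt by (metis norm_sgn)
  have id: "(\<lambda>x. x) \<in> ?S"
  proof -
    have "(\<lambda>x :: 'a. x) \<in> A_u" by (rule A_u_bounded_linear) auto
    moreover from this have "ball_norm (\<lambda>x :: 'a. x) = 1"
      using norm_le_ball_norm[OF A_u_C_b, of "\<lambda>x :: 'a. x" v] v ball_norm_least[of "\<lambda>x :: 'a. x" 1]
      by (intro antisym) auto
    ultimately show ?thesis by simp
  qed
  obtain x0 xs0 where P: "(x0 :: 'a, xs0) \<in> Pi_states" using Pi_states_nonempty[OF nt] by fastforce
  have "0 \<le> numerical_radius f" if "f \<in> ?S" for f
    using numerical_radius_ge[OF A_u_C_b P] that norm_ge_zero order_trans by blast
  then have bdd: "bdd_below (numerical_radius ` ?S)" by (auto intro!: bdd_belowI[of _ 0])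
  have "n_u TYPE('a) \<le> 1"
    unfolding n_u_def using cINF_lower[OF bdd id] numerical_radius_le[OF nt A_u_C_b, of "\<lambda>x. x"] id by simp
  then have "n_u TYPE('a) = 1 \<longleftrightarrow> 1 \<le> n_u TYPE('a)" by auto
  also have "\<dots> \<longleftrightarrow> (\<forall>f\<in>?S. 1 \<le> numerical_radius f)"
    unfolding n_u_def using id by (intro le_cINF_iff[OF _ bdd]) auto
  finally show ?thesis by auto
qed

lemma strong_peak_unimodular:
  fixes x0 :: "'a::complex_banach"
  assumes nt: "\<exists>x :: 'a. x \<noteq> 0" and n_u: "n_u TYPE('a) = 1"
    and x0: "x0 \<in> strong_peak_points (A_u :: ('a \<Rightarrow> complex) set)"
    and xs: "xs extreme_point_of (dual_ball :: ('a \<Rightarrow>\<^sub>L complex) set)"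
  shows "cmod (blinfun_apply xs x0) = 1"
proof (rule extreme_unimodular_if_norming[OF _ _ nt xs])
  obtain f :: "'a \<Rightarrow> complex" where f: "f \<in> A_u" and fne: "\<exists>x\<in>cball 0 1. f x \<noteq> 0" and x0: "x0 \<in> cball 0 1"
    and peak: "\<And>X. (\<And>n. X n \<in> cball 0 1) \<Longrightarrow> (\<lambda>n. norm (f (X n))) \<longlonglongrightarrow> ball_norm f \<Longrightarrow> X \<longlonglongrightarrow> x0"
    using x0 unfolding strong_peak_points_def strong_peak_at_def by blast
  show "norm x0 \<le> 1" using x0 by simp
  define M where "M = ball_norm f"
  obtain x1 where "norm x1 \<le> 1" "f x1 \<noteq> 0" using fne by auto
  then have M: "0 < M"
    unfolding M_def by (metis norm_le_ball_norm[OF A_u_C_b[OF f]] zero_less_norm_iff less_le_trans)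
  fix y :: 'a and d :: real assume y: "norm y = 1" and d: "0 < d"
  define g where "g x = (f x / M) *\<^sub>C y" for x
  have ng: "norm (g x) = cmod (f x) / M" for x
    using M by (simp add: g_def norm_scaleC y norm_divide)
  have g: "g \<in> A_u"
    unfolding g_def
    by (rule A_u_compose_bounded_linear[OF f])
      (auto simp: scaleC_complex_def scaleC_scaleC divide_inverse mult.assoc
        intro!: bounded_linear_compose[OF bounded_linear_scaleC_left bounded_linear_mult_left])
  have "ball_norm g = 1"
  proof (rule antisym)
    show "ball_norm g \<le> 1"
      using norm_le_ball_norm[OF A_u_C_b[OF f]] M by (intro ball_norm_least) (simp add: ng M_def)
    have "M \<le> ball_norm g * M"
      unfolding M_def
    proof (rule ball_norm_least)
      show "norm (f x) \<le> ball_norm g * ball_norm f" if "norm x \<le> 1" for x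
        using norm_le_ball_norm[OF A_u_C_b[OF g] that] M by (simp add: ng M_def[symmetric] field_simps)
    qed
    then show "1 \<le> ball_norm g" using M by simp
  qed
  then have v: "1 \<le> numerical_radius g" using n_u n_u_eq_1_iff[OF nt] g by blast
  have "\<exists>p\<in>Pi_states. 1 - inverse (Suc n) < cmod (blinfun_apply (snd p) (g (fst p)))" for n
  proof -
    have "0 < inverse (real (Suc n))" by simp
    then have "1 - inverse (real (Suc n)) < numerical_radius g" using v by linarith
    then obtain x xs where "(x, xs) \<in> Pi_states" "1 - inverse (Suc n) < cmod (blinfun_apply xs (g x))"
      by (rule numerical_radius_approx[OF nt A_u_C_b[OF g]])
    then show ?thesis by force
  qed
  then obtain P where P: "\<And>n. P n \<in> Pi_states"
    and Pg: "\<And>n. 1 - inverse (Suc n) < cmod (blinfun_apply (snd (P n)) (g (fst (P n))))" by metis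
  define X where "X n = fst (P n)" for n
  define Z where "Z n = snd (P n)" for n
  have Z: "Z n \<in> dual_ball" "blinfun_apply (Z n) (X n) = 1" and X: "norm (X n) \<le> 1" for n
    using P[of n] by (auto simp: Pi_states_def X_def Z_def)
  have le: "cmod (f (X n)) / M \<le> 1" "cmod (blinfun_apply (Z n) y) \<le> 1" for n
    using norm_le_ball_norm[OF A_u_C_b[OF f] X] M dual_ball_norm_le[OF Z(1), of n y] y by (auto simp: M_def)
  \<comment> \<open>At a state the modulus factors into |f| / M at the point and the functional at
    y. Both factors are at most 1, so a product close to 1 forces each to be close to 1: one drives
    \<open>X\<close> to the peak point, the other makes \<open>Z n\<close> almost norm y.\<close>
  have prod: "1 - inverse (Suc n) < cmod (f (X n)) / M * cmod (blinfun_apply (Z n) y)" for n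
    using Pg[of n] Z(1)[of n] M
    by (simp add: X_def Z_def g_def complex_dual_scaleC dual_ball_def norm_mult norm_divide)
  have fX: "1 - inverse (Suc n) < cmod (f (X n)) / M" for n
    by (rule less_le_trans[OF prod mult_left_le]) (use le M in auto)
  have Zy: "1 - inverse (Suc n) < cmod (blinfun_apply (Z n) y)" for n
    by (rule less_le_trans[OF prod mult_left_le_one_le]) (use le M in auto)
  have "(\<lambda>n. M * (1 - inverse (real (Suc n)))) \<longlonglongrightarrow> M * (1 - 0)"
    by (intro tendsto_intros LIMSEQ_inverse_real_of_nat)
  then have "(\<lambda>n. M * (1 - inverse (real (Suc n)))) \<longlonglongrightarrow> M" by simp
  then have "(\<lambda>n. norm (f (X n))) \<longlonglongrightarrow> M"
  proof (rule tendsto_sandwich[rotated 2, OF _ tendsto_const])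
    have "M * (1 - inverse (real (Suc n))) \<le> norm (f (X n))" for n
      using fX[of n] M by (simp add: less_divide_eq mult.commute less_imp_le)
    then show "\<forall>\<^sub>F n in sequentially. M * (1 - inverse (real (Suc n))) \<le> norm (f (X n))" by simp
    show "\<forall>\<^sub>F n in sequentially. norm (f (X n)) \<le> M"
      using norm_le_ball_norm[OF A_u_C_b[OF f] X] by (simp add: M_def)
  qed
  then have "X \<longlonglongrightarrow> x0" using peak[of X] X by (simp add: M_def)
  then have "\<forall>\<^sub>F n in sequentially. dist (X n) x0 < d" using d by (rule tendstoD)
  moreover have "\<forall>\<^sub>F n in sequentially. inverse (real (Suc n)) < d"
    by (rule order_tendstoD(2)[OF LIMSEQ_inverse_real_of_nat d])
  ultimately have "\<forall>\<^sub>F n in sequentially. dist (X n) x0 < d \<and> inverse (real (Suc n)) < d"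
    by (rule eventually_conj)
  then obtain n where n: "dist (X n) x0 < d" "inverse (real (Suc n)) < d"
    using eventually_happens'[OF sequentially_bot] by blast
  \<comment> \<open>The norming condition concerns the real part at y, so the functional is rotated
    until that value is nonnegative. The case distinction keeps c unimodular, as sgn 0 = 0.\<close>
  define c where "c = (if blinfun_apply (Z n) y = 0 then 1 else cnj (sgn (blinfun_apply (Z n) y)))"
  have c: "cmod c = 1" "c * blinfun_apply (Z n) y = cmod (blinfun_apply (Z n) y)"
    by (auto simp: c_def norm_sgn sgn_eq norm_divide complex_norm_square[symmetric] power2_eq_square mult.commute)
  obtain zs where zs: "zs \<in> dual_ball" "\<And>x. blinfun_apply zs x = c * blinfun_apply (Z n) x"
    using dual_ball_rotate[OF Z(1) c(1)] by blast
  have "1 \<le> cmod (blinfun_apply (Z n) x0) + cmod (blinfun_apply (Z n) (X n - x0))"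
    using norm_triangle_ineq[of "blinfun_apply (Z n) x0" "blinfun_apply (Z n) (X n - x0)"]
    by (simp add: blinfun.diff_right Z(2))
  also have "cmod (blinfun_apply (Z n) (X n - x0)) < d"
    using dual_ball_norm_le[OF Z(1), of n "X n - x0"] n(1) by (simp add: dist_norm)
  finally have "1 - d < cmod (blinfun_apply zs x0)" by (simp add: zs(2) norm_mult c(1))
  moreover have "1 - d < Re (blinfun_apply zs y)" using Zy[of n] n(2) by (simp add: zs(2) c(2))
  ultimately show "\<exists>xs\<in>dual_ball. 1 - d < cmod (blinfun_apply xs x0) \<and> 1 - d < Re (blinfun_apply xs y)"
    using zs(1) by blast
qed

text \<open>
  Since \<open>cmod (exp w) = exp (Re w)\<close>, a strong maximum of a perturbation of the real part of \<open>F\<close>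
  yields a strong peak function.
\<close>
lemma strong_peak_points_norming:
  fixes F :: "'a::complex_banach \<Rightarrow> complex"
  assumes dent: "all_dentable TYPE('a)" and F: "F \<in> A_u" and e: "0 < e" and y: "norm y \<le> 1"
  obtains x where "x \<in> strong_peak_points (A_u :: ('a \<Rightarrow> complex) set)" "norm x \<le> 1" "Re (F y) - e < Re (F x)"
proof -
  have bddF: "bdd_above ((\<lambda>x. Re (F x)) ` cball 0 1)"
    using order_trans[OF complex_Re_le_cmod norm_le_ball_norm[OF A_u_C_b[OF F]]]
    by (intro bdd_aboveI[of _ "ball_norm F"]) auto
  obtain w x where w: "norm (w :: 'a \<Rightarrow>\<^sub>L real) < e / 2" and x: "x \<in> cball 0 1"
    and max: "\<forall>X. (\<forall>n. X n \<in> cball 0 1) \<longrightarrow>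
      (\<lambda>n. Re (F (X n)) + w (X n)) \<longlonglongrightarrow> (SUP x\<in>cball 0 1. Re (F x) + w x) \<longrightarrow> X \<longlonglongrightarrow> x"
    by (rule stegall[OF dent closed_cball convex_cball bounded_cball _ bddF, of "e / 2"]) (use e in auto)
  \<comment> \<open>The perturbation \<open>w\<close> is only real-linear; its complex extension has
    real part \<open>w\<close> and keeps the sum holomorphic.\<close>
  define W where "W = complexify w"
  have wn: "w u \<le> norm w * norm u" for u using blinfun_abs_le[of w u] by linarith
  have W: "W \<in> complex_dual" "Re (blinfun_apply W u) = w u" for u
    unfolding W_def
    by (rule complexify_dual[of _ "norm w"] Re_complexify[of _ "norm w"];
        use wn in \<open>simp add: linear_iff blinfun.add_right blinfun.scaleR_right\<close>)+
  define H where "H u = F u + blinfun_apply W u" for u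
  define G where "G u = exp (H u)" for u
  have H: "H \<in> A_u"
    unfolding H_def
    by (intro A_u_add F A_u_bounded_linear blinfun.bounded_linear_right)
      (simp add: complex_dual_scaleC[OF W(1)] scaleC_complex_def)
  then have G: "G \<in> A_u" unfolding G_def by (rule A_u_exp)
  have ReH: "Re (H u) = Re (F u) + w u" for u by (simp add: H_def W)
  define s where "s = (SUP u\<in>cball 0 1. Re (H u))"
  have bddH: "bdd_above ((\<lambda>u. Re (H u)) ` cball 0 1)"
    using order_trans[OF complex_Re_le_cmod norm_le_ball_norm[OF A_u_C_b[OF H]]]
    by (intro bdd_aboveI[of _ "ball_norm H"]) auto
  have s: "Re (H u) \<le> s" if "norm u \<le> 1" for u
    unfolding s_def by (rule cSUP_upper[OF _ bddH]) (use that in auto)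
  have nG: "norm (G u) = exp (Re (H u))" for u by (simp add: G_def)
  have max': "X \<longlonglongrightarrow> x" if "\<And>n. X n \<in> cball 0 1" "(\<lambda>n. Re (H (X n))) \<longlonglongrightarrow> s" for X
    by (rule max[rule_format]) (use that in \<open>simp_all add: ReH s_def\<close>)
  have bG: "ball_norm G = exp s"
  proof (rule antisym)
    show "ball_norm G \<le> exp s" by (rule ball_norm_least) (simp add: nG s)
    have pos: "0 < ball_norm G" using norm_le_ball_norm[OF A_u_C_b[OF G], of 0] by (simp add: nG) (metis exp_gt_zero less_le_trans)
    have "s \<le> ln (ball_norm G)"
      unfolding s_def
    proof (rule cSUP_least)
      show "Re (H u) \<le> ln (ball_norm G)" if "u \<in> cball 0 1" for u
        using norm_le_ball_norm[OF A_u_C_b[OF G], of u] that pos by (simp add: nG ln_ge_iff)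
    qed simp
    then show "exp s \<le> ball_norm G" using pos by (simp add: ln_ge_iff)
  qed
  have "strong_peak_at G x"
    unfolding strong_peak_at_def
  proof (intro conjI allI impI)
    show "G \<in> C_b" by (rule A_u_C_b[OF G])
    show "\<exists>u\<in>cball 0 1. G u \<noteq> 0" by (intro bexI[of _ 0]) (auto simp: G_def)
    show "x \<in> cball 0 1" by (rule x)
    fix X assume X: "\<forall>n. X n \<in> cball 0 1" "(\<lambda>n. norm (G (X n))) \<longlonglongrightarrow> ball_norm G"
    have "(\<lambda>n. ln (norm (G (X n)))) \<longlonglongrightarrow> ln (ball_norm G)"
      by (rule tendsto_ln[OF X(2)]) (simp add: bG)
    then show "X \<longlonglongrightarrow> x" using X(1) by (intro max') (auto simp: bG nG)
  qed
  then have "x \<in> strong_peak_points (A_u :: ('a \<Rightarrow> complex) set)" using G unfolding strong_peak_points_def by blast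
  moreover have "Re (F y) - e < Re (F x)"
  proof -
    \<comment> \<open>Stegall's principle gives only convergence of maximizing sequences; continuity
      of \<open>H\<close> shows that x attains the supremum. Comparison with y then costs two values
      of \<open>w\<close>, each below e / 2.\<close>
    obtain X where X: "\<And>n. X n \<in> cball 0 1" "(\<lambda>n. Re (H (X n))) \<longlonglongrightarrow> s"
      using maximizing_sequence[OF _ bddH] unfolding s_def by auto
    have "continuous_on (cball 0 1) (\<lambda>u. Re (H u))"
      using H by (intro continuous_intros) (simp add: A_u_def C_b_def)
    then have "(\<lambda>n. Re (H (X n))) \<longlonglongrightarrow> Re (H x)"
      by (rule continuous_on_tendsto_compose[OF _ max'[OF X] x]) (use X in auto)
    then have "Re (H x) = s" using X(2) LIMSEQ_unique by blast
    then have "Re (F y) + w y \<le> Re (F x) + w x" using s[OF y] by (simp add: ReH)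
    moreover have "\<bar>w y\<bar> \<le> norm w" "\<bar>w x\<bar> \<le> norm w"
      using blinfun_abs_le[of w y] blinfun_abs_le[of w x] y x
        mult_left_le[of "norm y" "norm w"] mult_left_le[of "norm x" "norm w"] by auto
    ultimately show ?thesis using w by linarith
  qed
  ultimately show thesis using that x by auto
qed

text \<open>\<open>E\<close> stands for the extreme or for the weak-* exposed functionals. It is
  required to be only almost norming because a weak-* exposed functional is found by first moving z
  to a nearby smooth point.\<close>

lemma n_u_eq_1I:
  fixes E :: "('a::complex_banach \<Rightarrow>\<^sub>L complex) set"
  assumes nt: "\<exists>x :: 'a. x \<noteq> 0" and dent: "all_dentable TYPE('a)"
    and E: "E \<subseteq> dual_ball"
      "\<And>z e. z \<noteq> 0 \<Longrightarrow> 0 < e \<Longrightarrow> \<exists>xs\<in>E. norm z - e \<le> cmod (blinfun_apply xs z)"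
    and unimod: "\<And>x xs. x \<in> strong_peak_points (A_u :: ('a \<Rightarrow> complex) set) \<Longrightarrow> xs \<in> E \<Longrightarrow>
      cmod (blinfun_apply xs x) = 1"
  shows "n_u TYPE('a) = 1"
  unfolding n_u_eq_1_iff[OF nt]
proof (intro allI impI)
  fix f :: "'a \<Rightarrow> 'a" assume f: "f \<in> A_u" and f1: "ball_norm f = 1"
  show "1 \<le> numerical_radius f"
  proof (rule field_le_epsilon)
    fix e :: real assume e: "0 < e"
    \<comment> \<open>Three losses of d occur: in choosing y, in moving to a strong peak point x,
      and in norming f x by a member of \<open>E\<close>. The bound 1 / 4 keeps f x away from
      0.\<close>
    define d where "d = min (e / 3) (1 / 4)"
    have d: "0 < d" "3 * d \<le> e" "4 * d \<le> 1" using e by (auto simp: d_def)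
    have "1 - d < (SUP x\<in>cball 0 1. norm (f x))" using f1 d by (simp add: ball_norm_def)
    then obtain y where y: "norm y \<le> 1" "1 - d < norm (f y)"
      using less_cSUP_iff[OF _ C_b_bdd[OF A_u_C_b[OF f]]] by auto
    obtain ys :: "'a \<Rightarrow>\<^sub>L complex" where "ys extreme_point_of dual_ball" and ysf: "blinfun_apply ys (f y) = norm (f y)"
      by (rule extreme_dual_ball_norming)
    then have ys: "ys \<in> dual_ball" by (simp add: extreme_point_of_def)
    \<comment> \<open>A functional norming f y reduces to the scalar case; at the peak point its
      real part bounds the norm of f x from below.\<close>
    have "(\<lambda>x. blinfun_apply ys (f x)) \<in> A_u"
      using ys by (intro A_u_compose_bounded_linear[OF f] blinfun.bounded_linear_right)
        (simp add: dual_ball_def complex_dual_scaleC scaleC_complex_def)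
    then obtain x where x: "x \<in> strong_peak_points (A_u :: ('a \<Rightarrow> complex) set)" "norm x \<le> 1"
      and yx: "Re (blinfun_apply ys (f y)) - d < Re (blinfun_apply ys (f x))"
      by (rule strong_peak_points_norming[OF dent _ d(1) y(1)])
    have fx: "1 - 2 * d < norm (f x)"
      using yx y(2) dual_ball_Re_le[OF ys, of "f x"] by (simp add: ysf)
    then have "f x \<noteq> 0" using d by auto
    then obtain xs where xsE: "xs \<in> E" and xsf: "norm (f x) - d \<le> cmod (blinfun_apply xs (f x))"
      using E(2) d(1) by blast
    have xs: "xs \<in> dual_ball" and xsx: "cmod (blinfun_apply xs x) = 1"
      using E(1) xsE unimod[OF x(1)] by auto
    \<comment> \<open>Multiplying by the conjugate of the unimodular value at x gives value 1 there
      without changing any modulus, so x and \<open>zs\<close> form a state.\<close>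
    obtain zs where zs: "zs \<in> dual_ball" "\<And>u. blinfun_apply zs u = cnj (blinfun_apply xs x) * blinfun_apply xs u"
      using dual_ball_rotate[OF xs, of "cnj (blinfun_apply xs x)"] xsx by auto
    have zx: "blinfun_apply zs x = 1"
      using xsx by (simp add: zs(2) complex_norm_square[symmetric] mult.commute)
    have nx: "norm x = 1" using dual_ball_norm_le[OF xs, of x] xsx x(2) by simp
    then have "norm zs = 1"
      using norm_blinfun[of zs x] zs(1) zx by (auto simp: dual_ball_def)
    then have "(x, zs) \<in> Pi_states" using zs(1) zx nx by (simp add: Pi_states_def)
    then have "cmod (blinfun_apply zs (f x)) \<le> numerical_radius f"
      by (rule numerical_radius_ge[OF A_u_C_b[OF f]])
    then have "cmod (blinfun_apply xs (f x)) \<le> numerical_radius f"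
      by (simp add: zs(2) norm_mult xsx)
    then show "1 \<le> numerical_radius f + e" using xsf fx d(2) by linarith
  qed
qed

theorem proposition2p9:
  assumes nontrivial: "\<exists>x :: 'a::complex_banach. x \<noteq> 0"
    and RNP: "radon_nikodym_property TYPE('a)"
  shows "(n_u TYPE('a) = 1 \<longleftrightarrow>
            (\<forall>x\<in>strong_peak_points (A_u :: ('a \<Rightarrow> complex) set).
               \<forall>xs. xs extreme_point_of (dual_ball :: ('a \<Rightarrow>\<^sub>L complex) set) \<longrightarrow>
                 cmod (blinfun_apply xs x) = 1)) \<and>
         (separable_space (euclidean :: 'a topology) \<longrightarrow>
            (n_u TYPE('a) = 1 \<longleftrightarrow>
              (\<forall>x\<in>strong_peak_points (A_u :: ('a \<Rightarrow> complex) set).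
                 \<forall>xs\<in>(weak_star_exposed :: ('a \<Rightarrow>\<^sub>L complex) set).
                   cmod (blinfun_apply xs x) = 1)))"
proof -
  note dent = radon_nikodym_all_dentable[OF RNP]
  have ext: "n_u TYPE('a) = 1"
    if "\<forall>x\<in>strong_peak_points (A_u :: ('a \<Rightarrow> complex) set).
      \<forall>xs. xs extreme_point_of (dual_ball :: ('a \<Rightarrow>\<^sub>L complex) set) \<longrightarrow> cmod (blinfun_apply xs x) = 1"
  proof (rule n_u_eq_1I[OF nontrivial dent, of "{xs. xs extreme_point_of dual_ball}"])
    show "{xs. xs extreme_point_of dual_ball} \<subseteq> (dual_ball :: ('a \<Rightarrow>\<^sub>L complex) set)"
      by (auto simp: extreme_point_of_def)
    show "\<exists>xs\<in>{xs. xs extreme_point_of dual_ball}. norm z - e \<le> cmod (blinfun_apply xs z)"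
      if e: "0 < e" for z :: 'a and e
    proof -
      obtain xs where "xs extreme_point_of dual_ball" "blinfun_apply xs z = norm z"
        by (rule extreme_dual_ball_norming)
      then show ?thesis using e by (intro bexI[of _ xs]) auto
    qed
  qed (use that in auto)
  have exposed: "n_u TYPE('a) = 1"
    if sep: "separable_space (euclidean :: 'a topology)"
      and "\<forall>x\<in>strong_peak_points (A_u :: ('a \<Rightarrow> complex) set).
        \<forall>xs\<in>(weak_star_exposed :: ('a \<Rightarrow>\<^sub>L complex) set). cmod (blinfun_apply xs x) = 1"
  proof (rule n_u_eq_1I[OF nontrivial dent, of weak_star_exposed])
    show "weak_star_exposed \<subseteq> (dual_ball :: ('a \<Rightarrow>\<^sub>L complex) set)"
      by (auto simp: weak_star_exposed_def)
    show "\<exists>xs\<in>weak_star_exposed. norm z - e \<le> cmod (blinfun_apply xs z)"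
      if "z \<noteq> 0" "0 < e" for z :: 'a and e
      using mazur_weak_star_exposed[OF sep that] by blast
  qed (use that in auto)
  show ?thesis
    using ext exposed strong_peak_unimodular[OF nontrivial] weak_star_exposed_extreme by blast
qed

end
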